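(* Suppose the material tensor $\mathbb{M}$ is invertible (as a linear map on symmetric tangential tensors). Then the three-field bending functional $$\mathcal{L}_{\mathrm{bend}}(u,\kappa,\sigma)=\int_{\mathscr{T}}\frac{t^3}{24}\|\kappa\|_{\mathbb{M}}^2+\Big(\big(F^\top\nabla_{S}(\nu\circ\phi)-\nabla_{S}\hat\nu\big)-\kappa\Big):\sigma\,dx+\sum_{E}\int_E\big(\sphericalangle(\nu_L,\nu_R)\circ\phi-\sphericalangle(\hat\nu_L,\hat\nu_R)\big)\,\sigma_{\hat\mu\hat\mu}\,ds$$ is equivalent to the two-field functional $$\mathcal{L}_{\mathrm{bend}}(u,\sigma)=-\frac{6}{t^3}\int_{\mathscr{T}}\|\sigma\|_{\mathbb{M}^{-1}}^2\,dx+\int_{\mathscr{T}}\big(F^\top\nabla_{S}(\nu\circ\phi)-\nabla_{S}\hat\nu\big):\sigma\,dx+\sum_{E}\int_E\big(\sphericalangle(\nu_L,\nu_R)\circ\phi-\sphericalangle(\hat\nu_L,\hat\nu_R)\big)\,\sigma_{\hat\mu\hat\mu}\,ds$$ in the following sense: for all admissible $u$ and $\sigma$, eliminating $\kappa$ through its stationarity condition $D_\kappa\mathcal{L}_{\mathrm{bend}}(u,\kappa,\sigma)[\delta\kappa]=0$ for all $\delta\kappa$ is uniquely possible, and substituting the resulting $\kappa$ into $\mathcal{L}_{\mathrm{bend}}(u,\kappa,\sigma)$ yields $\mathcal{L}_{\mathrm{bend}}(u,\sigma)$. Moreover, the inverted material law is $$\|\sigma\|_{\mathbb{M}^{-1}}^2=\frac{1+\bar\nu}{\bar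 E}\Big(\sigma:\sigma-\frac{\bar\nu}{\bar\nu+1}\,\mathrm{tr}(\sigma)^2\Big).$$
   Context: Geometry. $\mathscr{T}$ is a finite triangulation by (possibly curved) smooth surface elements $T\subset\mathbb{R}^3$ (triangles and/or quadrilaterals), forming a continuous, oriented, not necessarily $C^1$ surface. On each element $T$, $\hat\nu$ is the unit normal and $P=I-\hat\nu\otimes\hat\nu$ is the projection onto the tangent plane. $\int_{\mathscr{T}}f\,dx=\sum_{T}\int_T f\,dx$. For a scalar function $f$ on $T$, $\nabla_S f=P\nabla F$ for any smooth extension $F$ of $f$ to a neighbourhood in $\mathbb{R}^3$; for vector-valued functions $\nabla_S$ is applied row-wise (the $i$-th row is $(\nabla_S u_i)^\top$). $A:B=\mathrm{tr}(A^\top B)$. On $\partial T$, $\hat\tau$ is the unit tangent to the edge and $\hat\mu=\hat\nu\times\hat\tau$ is the unit co-normal pointing out of $T$. $\sigma_{\hat\mu\hat\mu}=\hat\mu^\top\sigma\hat\mu$. The sum over $E$ runs over edges shared by two elements $T_L,T_R$, and $\hat\nu_L,\hat\nu_R$ are the normals of these elements; $\sphericalangle(a,b)=\arccos\frac{a\cdot b}{\|a\|\|b\|}$. Deformation. $u$ is a continuous, piecewise (element-wise) smooth $\mathbb{R}^3$-valued function on $\mathscr{T}$, $\phi=\mathrm{id}+u$, and $F=\nabla_S\phi=P+\nabla_S u$ is assumed to have rank two. The deformed normal is $\nu\circ\phi=\frac{\mathrm{cof}(F)\hat\nu}{\|\mathrm{cof}(F)\hat\nu\|}$, where $\mathrm{cof}$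 is the cofactor matrix; $\nu_L\circ\phi,\nu_R\circ\phi$ are its values from the two elements sharing an edge. Fields. $\sigma$ (bending moment) is piecewise smooth with values in symmetric tangential tensors ($\sigma^\top=\sigma$, $\sigma\hat\nu=0$), and $\sigma_{\hat\mu\hat\mu}$ is continuous across interior edges. $\kappa$ and its variations $\delta\kappa$ are arbitrary piecewise smooth functions with values in symmetric tangential tensors, without continuity across edges. Material law. $t>0$ is the thickness, $\bar E$ Young's modulus and $\bar\nu$ the Poisson ratio. $\mathbb{M}$ is the symmetric linear map on symmetric tangential tensors with $\|A\|_{\mathbb{M}}^2:=(\mathbb{M}A):A=\frac{\bar E}{1-\bar\nu^2}\big(\bar\nu\,\mathrm{tr}(A)^2+(1-\bar\nu)A:A\big)$, and $\|A\|^2_{\mathbb{M}^{-1}}:=(\mathbb{M}^{-1}A):A$. *)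

theory Defs
  imports "HOL-Analysis.Analysis"
begin

section \<open>Smooth functions\<close>

fun Ck_on :: "nat \<Rightarrow> 'a::real_normed_vector set \<Rightarrow> ('a \<Rightarrow> 'b::real_normed_vector) \<Rightarrow> bool" where
  "Ck_on 0 U f \<longleftrightarrow> continuous_on U f"
| "Ck_on (Suc k) U f \<longleftrightarrow> (\<forall>x\<in>U. f differentiable (at x)) \<and>
     (\<forall>v. Ck_on k U (\<lambda>x. frechet_derivative f (at x) v))"

text \<open>Meant for open \<open>U\<close>, where it says that \<open>f\<close> is infinitely often continuously differentiable.\<close>
definition smooth_open :: "'a::real_normed_vector set \<Rightarrow> ('a \<Rightarrow> 'b::real_normed_vector) \<Rightarrow> bool" where
  "smooth_open U f \<longleftrightarrow> (\<forall>k. Ck_on k U f)"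

definition smooth_extension ::
  "'a::real_normed_vector set \<Rightarrow> ('a \<Rightarrow> 'b::real_normed_vector) \<Rightarrow> ('a \<Rightarrow> 'b) \<Rightarrow> bool" where
  "smooth_extension S f f' \<longleftrightarrow>
     (\<exists>U. open U \<and> S \<subseteq> U \<and> smooth_open U f') \<and> (\<forall>x\<in>S. f' x = f x)"

text \<open>On an arbitrary set, smooth means: restriction of a function that is smooth on a
  neighbourhood. On an element this is smoothness up to the edges.\<close>
definition smooth_on_set ::
  "'a::real_normed_vector set \<Rightarrow> ('a \<Rightarrow> 'b::real_normed_vector) \<Rightarrow> bool" where
  "smooth_on_set S f \<longleftrightarrow> (\<exists>f'. smooth_extension S f f')"

section \<open>Tensors\<close>

definition frob :: "real^3^3 \<Rightarrow> real^3^3 \<Rightarrow> real"  (infix \<open>\<Colon>\<close> 70) where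
  "A \<Colon> B = trace (transpose A ** B)"

text \<open>The determinant below is the signed minor obtained by deleting row \<open>i\<close> and column \<open>j\<close>.\<close>
definition cof :: "real^3^3 \<Rightarrow> real^3^3" where
  "cof A = (\<chi> i j. det (\<chi> k l. if k = i \<and> l = j then 1
                               else if k = i \<or> l = j then 0 else A $ k $ l))"

definition angle :: "real^3 \<Rightarrow> real^3 \<Rightarrow> real" where
  "angle a b = arccos ((a \<bullet> b) / (norm a * norm b))"

definition tangent_proj :: "real^3 \<Rightarrow> real^3^3" where
  "tangent_proj n = mat 1 - (\<chi> i j. n $ i * n $ j)"

text \<open>The symmetric tangential tensors at a point with unit normal \<open>n\<close>.\<close>
definition symtan :: "real^3 \<Rightarrow> (real^3^3) set" where
  "symtan n = {A. transpose A = A \<and> A *v n = 0}"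

section \<open>Material law\<close>

text \<open>The tensors on which the material tensor acts depend on the tangent plane, so
  it is a family indexed by the unit normal \<open>n\<close>; outside \<open>symtan n\<close> the map \<open>M n\<close> is
  unconstrained.\<close>
definition material_tensor ::
  "real \<Rightarrow> real \<Rightarrow> (real^3 \<Rightarrow> real^3^3 \<Rightarrow> real^3^3) \<Rightarrow> bool" where
  "material_tensor Y p M \<longleftrightarrow> (\<forall>n. norm n = 1 \<longrightarrow>
     (\<forall>A\<in>symtan n. M n A \<in> symtan n) \<and>
     (\<forall>A\<in>symtan n. \<forall>B\<in>symtan n. M n (A + B) = M n A + M n B) \<and>
     (\<forall>c. \<forall>A\<in>symtan n. M n (c *\<^sub>R A) = c *\<^sub>R M n A) \<and>
     (\<forall>A\<in>symtan n. \<forall>B\<in>symtan n. M n A \<Colon> B = A \<Colon> M n B) \<and>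
     (\<forall>A\<in>symtan n. M n A \<Colon> A = Y / (1 - p^2) * (p * (trace A)^2 + (1 - p) * (A \<Colon> A))))"

definition invertible_material :: "(real^3 \<Rightarrow> real^3^3 \<Rightarrow> real^3^3) \<Rightarrow> bool" where
  "invertible_material M \<longleftrightarrow> (\<forall>n. norm n = 1 \<longrightarrow> bij_betw (M n) (symtan n) (symtan n))"

definition material_inverse ::
  "(real^3 \<Rightarrow> real^3^3 \<Rightarrow> real^3^3) \<Rightarrow> real^3 \<Rightarrow> real^3^3 \<Rightarrow> real^3^3" where
  "material_inverse M n = inv_into (symtan n) (M n)"

text \<open>The squared norm \<open>(M n A) : A\<close>, to be used with a material tensor or its inverse.\<close>
definition sqnorm :: "(real^3 \<Rightarrow> real^3^3 \<Rightarrow> real^3^3) \<Rightarrow> real^3 \<Rightarrow> real^3^3 \<Rightarrow> real" where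
  "sqnorm M n A = M n A \<Colon> A"

section \<open>Surface elements\<close>

datatype shape = Triangle | Quadrilateral

text \<open>Vertices of the reference triangle and of the unit square, counterclockwise.\<close>
fun ref_vertices :: "shape \<Rightarrow> (real^2) list" where
  "ref_vertices Triangle = [0, axis 1 1, axis 2 1]"
| "ref_vertices Quadrilateral = [0, axis 1 1, axis 1 1 + axis 2 1, axis 2 1]"

text \<open>An element is given by a shape and a parametrization over the reference domain; the
  order of the parameters fixes the orientation.\<close>
datatype element = Element (elt_shape: shape) (elt_map: "real^2 \<Rightarrow> real^3")

definition ref_dom :: "element \<Rightarrow> (real^2) set" where
  "ref_dom e = convex hull (set (ref_vertices (elt_shape e)))"

definition elt_set :: "element \<Rightarrow> (real^3) set" where
  "elt_set e = elt_map e ` ref_dom e"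

definition elt_coord :: "element \<Rightarrow> real^3 \<Rightarrow> real^2" where
  "elt_coord e = inv_into (ref_dom e) (elt_map e)"

text \<open>The parametrization is a diffeomorphism of the reference domain onto the element (as
  subsets of Euclidean spaces). In particular its derivative has rank two up to the boundary.\<close>
definition surface_element :: "element \<Rightarrow> bool" where
  "surface_element e \<longleftrightarrow>
     (\<exists>W. open W \<and> ref_dom e \<subseteq> W \<and> smooth_open W (elt_map e)) \<and>
     inj_on (elt_map e) (ref_dom e) \<and>
     smooth_on_set (elt_set e) (elt_coord e)"

definition area_vector :: "element \<Rightarrow> real^2 \<Rightarrow> real^3" where
  "area_vector e y = cross3 (frechet_derivative (elt_map e) (at y) (axis 1 1))
                            (frechet_derivative (elt_map e) (at y) (axis 2 1))"

definition elt_normal :: "element \<Rightarrow> real^3 \<Rightarrow> real^3" where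
  "elt_normal e x = (let a = area_vector e (elt_coord e x) in a /\<^sub>R norm a)"

definition elt_integral :: "element \<Rightarrow> (real^3 \<Rightarrow> real) \<Rightarrow> real" where
  "elt_integral e f = (LINT y:ref_dom e|lborel. f (elt_map e y) * norm (area_vector e y))"

subsection \<open>Surface gradient\<close>

definition gradient :: "(real^3 \<Rightarrow> real) \<Rightarrow> real^3 \<Rightarrow> real^3" where
  "gradient f x = (\<chi> i. frechet_derivative f (at x) (axis i 1))"

text \<open>For smooth \<open>f\<close> the value on the element is independent of the chosen extension.\<close>
definition surf_grad :: "element \<Rightarrow> (real^3 \<Rightarrow> real) \<Rightarrow> real^3 \<Rightarrow> real^3" where
  "surf_grad e f x =
     tangent_proj (elt_normal e x) *v gradient (SOME f'. smooth_extension (elt_set e) f f') x"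

definition surf_jac :: "element \<Rightarrow> (real^3 \<Rightarrow> real^3) \<Rightarrow> real^3 \<Rightarrow> real^3^3" where
  "surf_jac e v x = (\<chi> i. surf_grad e (\<lambda>z. v z $ i) x)"

subsection \<open>Sides\<close>

text \<open>A side is a pair of an element and the number of one of its edges.\<close>
type_synonym side = "element \<times> nat"

fun ref_start :: "side \<Rightarrow> real^2" where
  "ref_start (e, i) = ref_vertices (elt_shape e) ! i"

fun ref_end :: "side \<Rightarrow> real^2" where
  "ref_end (e, i) = (let vs = ref_vertices (elt_shape e) in vs ! (Suc i mod length vs))"

definition side_path :: "side \<Rightarrow> real \<Rightarrow> real^3" where
  "side_path s r = elt_map (fst s) (linepath (ref_start s) (ref_end s) r)"

definition edge :: "side \<Rightarrow> (real^3) set" where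
  "edge s = side_path s ` {0..1}"

definition edge_integral :: "side \<Rightarrow> (real^3 \<Rightarrow> real) \<Rightarrow> real" where
  "edge_integral s f =
     (LINT r:{0..1}|lborel. f (side_path s r) * norm (vector_derivative (side_path s) (at r)))"

text \<open>The tangent runs clockwise as seen from the normal: this is the direction for which
  normal \<open>\<times>\<close> tangent points out of the element.\<close>
definition side_tangent :: "side \<Rightarrow> real^3 \<Rightarrow> real^3" where
  "side_tangent s x =
     (let d = frechet_derivative (elt_map (fst s)) (at (elt_coord (fst s) x)) (ref_start s - ref_end s)
      in d /\<^sub>R norm d)"

definition conormal :: "side \<Rightarrow> real^3 \<Rightarrow> real^3" where
  "conormal s x = cross3 (elt_normal (fst s) x) (side_tangent s x)"

section \<open>Triangulated surfaces\<close>

definition elt_vertices :: "element \<Rightarrow> (real^3) set" where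
  "elt_vertices e = elt_map e ` set (ref_vertices (elt_shape e))"

definition sides :: "element set \<Rightarrow> side set" where
  "sides \<T> = {(e, i). e \<in> \<T> \<and> i < length (ref_vertices (elt_shape e))}"

definition interior_edges :: "element set \<Rightarrow> (real^3) set set" where
  "interior_edges \<T> =
     {E. \<exists>s\<in>sides \<T>. \<exists>s'\<in>sides \<T>. fst s \<noteq> fst s' \<and> edge s = E \<and> edge s' = E}"

definition topological_surface :: "(real^3) set \<Rightarrow> bool" where
  "topological_surface S \<longleftrightarrow>
     (\<forall>x\<in>S. \<exists>U V. openin (top_of_set S) U \<and> x \<in> U \<and>
        openin (top_of_set {y::real^2. y $ 2 \<ge> 0}) V \<and> U homeomorphic V)"

text \<open>Distinct elements meet only in common vertices and edges. That their union is a
  surface (possibly with boundary) implies that an edge belongs to at most two elements.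
  The surface is oriented by the normals, that is, neighbouring elements run
  through a common edge in opposite directions.\<close>
definition surface_triangulation :: "element set \<Rightarrow> bool" where
  "surface_triangulation \<T> \<longleftrightarrow>
     finite \<T> \<and> (\<forall>e\<in>\<T>. surface_element e) \<and>
     (\<forall>e\<in>\<T>. \<forall>e'\<in>\<T>. e \<noteq> e' \<longrightarrow> (\<forall>x \<in> elt_set e \<inter> elt_set e'.
        x \<in> elt_vertices e \<inter> elt_vertices e' \<or>
        (\<exists>i i'. (e, i) \<in> sides \<T> \<and> (e', i') \<in> sides \<T> \<and> edge (e, i) = edge (e', i') \<and>
                x \<in> edge (e, i)))) \<and>
     topological_surface (\<Union>e\<in>\<T>. elt_set e) \<and>
     (\<forall>s\<in>sides \<T>. \<forall>s'\<in>sides \<T>. fst s \<noteq> fst s' \<and> edge s = edge s' \<longrightarrow>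
        (\<forall>x\<in>edge s. side_tangent s x = - side_tangent s' x))"

text \<open>\<open>L E\<close> and \<open>R E\<close> are the edge \<open>E\<close> seen as a side of its left and right element.
  The labelling is arbitrary.\<close>
definition edge_labelling ::
  "element set \<Rightarrow> ((real^3) set \<Rightarrow> side) \<Rightarrow> ((real^3) set \<Rightarrow> side) \<Rightarrow> bool" where
  "edge_labelling \<T> L R \<longleftrightarrow> (\<forall>E\<in>interior_edges \<T>.
     L E \<in> sides \<T> \<and> R E \<in> sides \<T> \<and> fst (L E) \<noteq> fst (R E) \<and> edge (L E) = E \<and> edge (R E) = E)"

text \<open>Functions without continuity across edges are families indexed by the elements.\<close>
definition surf_integral :: "element set \<Rightarrow> (element \<Rightarrow> real^3 \<Rightarrow> real) \<Rightarrow> real" where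
  "surf_integral \<T> f = (\<Sum>e\<in>\<T>. elt_integral e (f e))"

section \<open>Admissible fields\<close>

definition deform_grad :: "(real^3 \<Rightarrow> real^3) \<Rightarrow> element \<Rightarrow> real^3 \<Rightarrow> real^3^3" where
  "deform_grad u e = surf_jac e (\<lambda>x. x + u x)"

text \<open>The deformed normal as a function on the undeformed element, i.e. composed with the
  deformation.\<close>
definition deformed_normal :: "(real^3 \<Rightarrow> real^3) \<Rightarrow> element \<Rightarrow> real^3 \<Rightarrow> real^3" where
  "deformed_normal u e x =
     (let a = cof (deform_grad u e x) *v elt_normal e x in a /\<^sub>R norm a)"

definition admissible_displacement :: "element set \<Rightarrow> (real^3 \<Rightarrow> real^3) \<Rightarrow> bool" where
  "admissible_displacement \<T> u \<longleftrightarrow>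
     continuous_on (\<Union>e\<in>\<T>. elt_set e) u \<and>
     (\<forall>e\<in>\<T>. smooth_on_set (elt_set e) u \<and> (\<forall>x\<in>elt_set e. rank (deform_grad u e x) = 2))"

definition symtan_field :: "element set \<Rightarrow> (element \<Rightarrow> real^3 \<Rightarrow> real^3^3) \<Rightarrow> bool" where
  "symtan_field \<T> \<kappa> \<longleftrightarrow>
     (\<forall>e\<in>\<T>. smooth_on_set (elt_set e) (\<kappa> e) \<and> (\<forall>x\<in>elt_set e. \<kappa> e x \<in> symtan (elt_normal e x)))"

definition normal_normal :: "(element \<Rightarrow> real^3 \<Rightarrow> real^3^3) \<Rightarrow> side \<Rightarrow> real^3 \<Rightarrow> real" where
  "normal_normal \<sigma> s x = conormal s x \<bullet> (\<sigma> (fst s) x *v conormal s x)"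

definition admissible_moment :: "element set \<Rightarrow> (element \<Rightarrow> real^3 \<Rightarrow> real^3^3) \<Rightarrow> bool" where
  "admissible_moment \<T> \<sigma> \<longleftrightarrow> symtan_field \<T> \<sigma> \<and>
     (\<forall>s\<in>sides \<T>. \<forall>s'\<in>sides \<T>. fst s \<noteq> fst s' \<and> edge s = edge s' \<longrightarrow>
        (\<forall>x\<in>edge s. normal_normal \<sigma> s x = normal_normal \<sigma> s' x))"

section \<open>Bending functionals\<close>

definition curvature_diff :: "(real^3 \<Rightarrow> real^3) \<Rightarrow> element \<Rightarrow> real^3 \<Rightarrow> real^3^3" where
  "curvature_diff u e x =
     transpose (deform_grad u e x) ** surf_jac e (deformed_normal u e) x
       - surf_jac e (elt_normal e) x"

text \<open>By the continuity of \<open>\<sigma>\<close> in the conormal direction it does not matter from which of the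
  two elements it is evaluated.\<close>
definition edge_term ::
  "element set \<Rightarrow> ((real^3) set \<Rightarrow> side) \<Rightarrow> ((real^3) set \<Rightarrow> side) \<Rightarrow>
   (real^3 \<Rightarrow> real^3) \<Rightarrow> (element \<Rightarrow> real^3 \<Rightarrow> real^3^3) \<Rightarrow> real" where
  "edge_term \<T> L R u \<sigma> = (\<Sum>E\<in>interior_edges \<T>. edge_integral (L E) (\<lambda>x.
     (angle (deformed_normal u (fst (L E)) x) (deformed_normal u (fst (R E)) x)
       - angle (elt_normal (fst (L E)) x) (elt_normal (fst (R E)) x)) * normal_normal \<sigma> (L E) x))"

definition bend3 ::
  "element set \<Rightarrow> ((real^3) set \<Rightarrow> side) \<Rightarrow> ((real^3) set \<Rightarrow> side) \<Rightarrow>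
   (real^3 \<Rightarrow> real^3^3 \<Rightarrow> real^3^3) \<Rightarrow> real \<Rightarrow>
   (real^3 \<Rightarrow> real^3) \<Rightarrow> (element \<Rightarrow> real^3 \<Rightarrow> real^3^3) \<Rightarrow> (element \<Rightarrow> real^3 \<Rightarrow> real^3^3) \<Rightarrow> real" where
  "bend3 \<T> L R M t u \<kappa> \<sigma> =
     surf_integral \<T> (\<lambda>e x. t^3 / 24 * sqnorm M (elt_normal e x) (\<kappa> e x)
                            + (curvature_diff u e x - \<kappa> e x) \<Colon> \<sigma> e x)
     + edge_term \<T> L R u \<sigma>"

definition bend2 ::
  "element set \<Rightarrow> ((real^3) set \<Rightarrow> side) \<Rightarrow> ((real^3) set \<Rightarrow> side) \<Rightarrow>
   (real^3 \<Rightarrow> real^3^3 \<Rightarrow> real^3^3) \<Rightarrow> real \<Rightarrow>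
   (real^3 \<Rightarrow> real^3) \<Rightarrow> (element \<Rightarrow> real^3 \<Rightarrow> real^3^3) \<Rightarrow> real" where
  "bend2 \<T> L R M t u \<sigma> =
     - 6 / t^3 * surf_integral \<T> (\<lambda>e x. sqnorm (material_inverse M) (elt_normal e x) (\<sigma> e x))
     + surf_integral \<T> (\<lambda>e x. curvature_diff u e x \<Colon> \<sigma> e x)
     + edge_term \<T> L R u \<sigma>"

text \<open>The directional derivative with respect to \<open>\<kappa>\<close> exists and vanishes in all directions.\<close>
definition stationary_curvature ::
  "element set \<Rightarrow> ((real^3) set \<Rightarrow> side) \<Rightarrow> ((real^3) set \<Rightarrow> side) \<Rightarrow>
   (real^3 \<Rightarrow> real^3^3 \<Rightarrow> real^3^3) \<Rightarrow> real \<Rightarrow>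
   (real^3 \<Rightarrow> real^3) \<Rightarrow> (element \<Rightarrow> real^3 \<Rightarrow> real^3^3) \<Rightarrow> (element \<Rightarrow> real^3 \<Rightarrow> real^3^3) \<Rightarrow> bool" where
  "stationary_curvature \<T> L R M t u \<sigma> \<kappa> \<longleftrightarrow> (\<forall>\<delta>. symtan_field \<T> \<delta> \<longrightarrow>
     ((\<lambda>s. bend3 \<T> L R M t u (\<lambda>e x. \<kappa> e x + s *\<^sub>R \<delta> e x) \<sigma>) has_real_derivative 0) (at 0))"

end

theory Submission
  imports Defs
begin

text \<open>
  The curvature enters the three-field functional only through the integrals over the elements,
  and there pointwise and quadratically. Along a line \<open>\<kappa> + s \<delta>\<close> the functional is therefore a
  quadratic polynomial in \<open>s\<close>, whose linear coefficient is the integral of \<open>r : \<delta>\<close> with the residual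
  \<open>r = (t^3/12) M \<kappa> - \<sigma>\<close> (lemma \<open>bend3_along_line\<close>). The residual is itself a smooth symmetric
  tangential field, hence a legitimate direction; the choice \<open>\<delta> = r\<close> turns stationarity
  into a vanishing integral of the continuous function \<open>r : r\<close>, so that \<open>r = 0\<close> everywhere
  (lemma \<open>stationary_curvature_iff\<close>). As \<open>M\<close> is invertible, this determines
  \<open>\<kappa> = (12/t^3) M\<^sup>-\<^sup>1 \<sigma>\<close>, and inserting this curvature leaves
  \<open>(1/2 - 1) (12/t^3) (M\<^sup>-\<^sup>1 \<sigma>) : \<sigma> = - (6/t^3) (M\<^sup>-\<^sup>1 \<sigma>) : \<sigma>\<close> under the integral.

  Two points need work. First, the Lebesgue integral is additive only on integrable functions, so
  the term \<open>(F\<^sup>T grad \<nu> - grad \<nu>\<^sub>0) : \<sigma>\<close> must be shown to be integrable, although it does not involve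
  the curvature. Its continuity up to the boundary follows from smoothness of both normals
  (lemma \<open>curvature_diff_smooth\<close>). For the undeformed normal this rests on the regularity of
  the parametrization up to the boundary, for the deformed one on \<open>cof F n \<noteq> 0\<close>, which holds because
  \<open>F\<close> has rank two and kernel \<open>n\<close>. As surface gradients are defined by smooth
  extensions, smoothness has to be propagated through products, compositions and normalization.

  Second, the material tensor is given by its quadratic form. Polarization shows that on symmetric
  tangential tensors \<open>M A = Y/(1-p^2) (p tr(A) P + (1-p) A)\<close> with the tangential projection \<open>P\<close>
  (lemma \<open>material_tensor_formula\<close>). Invertibility then forces \<open>Y \<noteq> 0\<close> and \<open>p^2 \<noteq> 1\<close>, and the formula
  can be inverted by hand. The two formulas also show that \<open>M\<close> and its inverse map smooth fields to
  smooth fields.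
\<close>

section \<open>Calculus of smooth functions\<close>

lemma has_derivative_eq_on_open:
  assumes "open U" "x \<in> U" "\<And>y. y \<in> U \<Longrightarrow> f y = g y" "(g has_derivative D) (at x)"
  shows "(f has_derivative D) (at x)"
  using assms by (metis has_derivative_transform_within_open)

lemma Ck_on_cong:
  assumes "open U" "\<And>x. x \<in> U \<Longrightarrow> f x = g x" "Ck_on k U g"
  shows "Ck_on k U f"
  using assms(2,3)
proof (induction k arbitrary: f g)
  case 0
  then show ?case by (simp cong: continuous_on_cong)
next
  case (Suc k)
  have D: "(f has_derivative frechet_derivative g (at x)) (at x)" if "x \<in> U" for x
  proof (rule has_derivative_eq_on_open[OF assms(1) that, of f g])
    show "(g has_derivative frechet_derivative g (at x)) (at x)"
      using Suc.prems(2) that by (simp add: frechet_derivative_works[symmetric])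
  qed (rule Suc.prems(1))
  have "Ck_on k U (\<lambda>x. frechet_derivative f (at x) v)" for v
  proof (rule Suc.IH)
    show "frechet_derivative f (at x) v = frechet_derivative g (at x) v" if "x \<in> U" for x
      using frechet_derivative_at[OF D[OF that]] by simp
    show "Ck_on k U (\<lambda>x. frechet_derivative g (at x) v)"
      using Suc.prems(2) by simp
  qed
  moreover have "f differentiable (at x)" if "x \<in> U" for x
    using D[OF that] by (rule differentiableI)
  ultimately show ?case by simp
qed

text \<open>Reduces differentiability of order \<open>k + 1\<close> to a formula for the derivative, so that the
  closure properties below follow by induction from the classical differentiation rules.\<close>

lemma Ck_on_SucI:
  assumes "open U" "\<And>x. x \<in> U \<Longrightarrow> (f has_derivative f' x) (at x)" "\<And>v. Ck_on k U (\<lambda>x. f' x v)"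
  shows "Ck_on (Suc k) U f"
proof -
  have "Ck_on k U (\<lambda>x. frechet_derivative f (at x) v)" for v
  proof (rule Ck_on_cong[OF assms(1) _ assms(3)[of v]])
    show "frechet_derivative f (at x) v = f' x v" if "x \<in> U" for x
      using frechet_derivative_at[OF assms(2)[OF that]] by simp
  qed
  moreover have "f differentiable (at x)" if "x \<in> U" for x
    using assms(2)[OF that] by (rule differentiableI)
  ultimately show ?thesis by simp
qed

lemma Ck_on_SucD:
  assumes "Ck_on (Suc k) U f"
  shows "x \<in> U \<Longrightarrow> (f has_derivative frechet_derivative f (at x)) (at x)"
    and "Ck_on k U (\<lambda>x. frechet_derivative f (at x) v)"
  using assms by (simp_all add: frechet_derivative_works[symmetric])

lemma Ck_on_lower: "Ck_on (Suc k) U f \<Longrightarrow> Ck_on k U f"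
proof (induction k arbitrary: f)
  case 0
  then show ?case
    by (auto intro!: continuous_at_imp_continuous_on differentiable_imp_continuous_within)
next
  case (Suc k)
  then have "Ck_on k U (\<lambda>x. frechet_derivative f (at x) v)" for v
    using Suc.IH Ck_on_SucD(2) by blast
  with Suc.prems show ?case by auto
qed

lemma Ck_on_subset: "Ck_on k U f \<Longrightarrow> V \<subseteq> U \<Longrightarrow> Ck_on k V f"
  by (induction k arbitrary: f) (auto intro: continuous_on_subset)

lemma Ck_on_const: "open U \<Longrightarrow> Ck_on k U (\<lambda>x. c)"
proof (induction k arbitrary: c)
  case (Suc k)
  then show ?case by (intro Ck_on_SucI[where f' = "\<lambda>x v. 0"]) auto
qed simp

lemma Ck_on_bounded_linear:
  assumes "open U" "bounded_linear h" "Ck_on k U f"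
  shows "Ck_on k U (\<lambda>x. h (f x))"
  using assms(3)
proof (induction k arbitrary: f)
  case 0
  then show ?case using assms(2) by (simp add: bounded_linear.continuous_on)
next
  case (Suc k)
  show ?case
    by (rule Ck_on_SucI[OF assms(1) bounded_linear.has_derivative[OF assms(2)
          Ck_on_SucD(1)[OF Suc.prems]] Suc.IH[OF Ck_on_SucD(2)[OF Suc.prems]]])
qed

lemma Ck_on_add:
  assumes "open U" "Ck_on k U f" "Ck_on k U g"
  shows "Ck_on k U (\<lambda>x. f x + g x)"
  using assms(2,3)
proof (induction k arbitrary: f g)
  case 0
  then show ?case by (simp add: continuous_on_add)
next
  case (Suc k)
  show ?case
    by (rule Ck_on_SucI[OF assms(1) has_derivative_add[OF Ck_on_SucD(1)[OF Suc.prems(1)]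
          Ck_on_SucD(1)[OF Suc.prems(2)]] Suc.IH[OF Ck_on_SucD(2)[OF Suc.prems(1)]
          Ck_on_SucD(2)[OF Suc.prems(2)]]])
qed

lemma Ck_on_sum:
  assumes "open U" "\<And>i. i \<in> I \<Longrightarrow> Ck_on k U (f i)"
  shows "Ck_on k U (\<lambda>x. \<Sum>i\<in>I. f i x)"
  using assms(2)
  by (induction I rule: infinite_finite_induct) (auto intro: Ck_on_const Ck_on_add assms(1))

lemma Ck_on_bounded_bilinear:
  assumes "open U" "bounded_bilinear h" "Ck_on k U f" "Ck_on k U g"
  shows "Ck_on k U (\<lambda>x. h (f x) (g x))"
  using assms(3,4)
proof (induction k arbitrary: f g)
  case 0
  then show ?case using assms(2) by (simp add: bounded_bilinear.continuous_on)
next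
  case (Suc k)
  show ?case
  proof (rule Ck_on_SucI[OF assms(1)])
    show "((\<lambda>x. h (f x) (g x)) has_derivative (\<lambda>v. h (f x) (frechet_derivative g (at x) v)
             + h (frechet_derivative f (at x) v) (g x))) (at x)" if "x \<in> U" for x
      by (rule bounded_bilinear.FDERIV[OF assms(2) Ck_on_SucD(1)[OF Suc.prems(1) that]
            Ck_on_SucD(1)[OF Suc.prems(2) that]])
    show "Ck_on k U (\<lambda>x. h (f x) (frechet_derivative g (at x) v)
             + h (frechet_derivative f (at x) v) (g x))" for v
      by (rule Ck_on_add[OF assms(1) Suc.IH[OF Ck_on_lower Ck_on_SucD(2)]
            Suc.IH[OF Ck_on_SucD(2) Ck_on_lower]]) (rule Suc.prems)+
  qed
qed

text \<open>The chain rule produces \<open>Dg (f x) (Df x v)\<close>, where the direction depends on \<open>x\<close>, whereas the induction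
  hypothesis speaks of derivatives in a fixed direction. Expanding \<open>Df x v\<close> in a basis
  separates the two dependencies; this is where the intermediate space must be finite-dimensional.\<close>

lemma Ck_on_compose:
  fixes f :: "'a::real_normed_vector \<Rightarrow> 'b::euclidean_space"
  assumes "open U" "f ` U \<subseteq> V" "Ck_on k U f" "Ck_on k V g"
  shows "Ck_on k U (\<lambda>x. g (f x))"
  using assms(3,4)
proof (induction k arbitrary: g)
  case 0
  then show ?case using assms(2) by (auto intro: continuous_on_compose2)
next
  case (Suc k)
  let ?D = "\<lambda>x v. \<Sum>b\<in>Basis. (frechet_derivative f (at x) v \<bullet> b) *\<^sub>R frechet_derivative g (at (f x)) b"
  show ?case
  proof (rule Ck_on_SucI[OF assms(1)])
    fix x assume x: "x \<in> U"
    then have "f x \<in> V" using assms(2) by blast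
    then have g: "(g has_derivative frechet_derivative g (at (f x))) (at (f x))"
      using Ck_on_SucD(1)[OF Suc.prems(2)] by blast
    have expand: "frechet_derivative g (at (f x)) w = (\<Sum>b\<in>Basis. (w \<bullet> b) *\<^sub>R frechet_derivative g (at (f x)) b)" for w
      using has_derivative_linear[OF g]
      by (subst euclidean_representation[of w, symmetric]) (simp only: linear_sum linear_scale)
    show "((\<lambda>x. g (f x)) has_derivative ?D x) (at x)"
      using has_derivative_compose[OF Ck_on_SucD(1)[OF Suc.prems(1) x] g]
      by (simp only: expand[symmetric])
  next
    fix v
    have "Ck_on k U (\<lambda>x. frechet_derivative f (at x) v \<bullet> b)" for b
      using Ck_on_bounded_linear[OF assms(1) bounded_linear_inner_left] Ck_on_SucD(2)[OF Suc.prems(1)]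
      by blast
    moreover have "Ck_on k U (\<lambda>x. frechet_derivative g (at (f x)) b)" for b
      using Suc.IH[OF Ck_on_lower[OF Suc.prems(1)] Ck_on_SucD(2)[OF Suc.prems(2)]] .
    ultimately show "Ck_on k U (\<lambda>x. ?D x v)"
      by (intro Ck_on_sum[OF assms(1)] Ck_on_bounded_bilinear[OF assms(1) bounded_bilinear_scaleR])
  qed
qed

text \<open>The function \<open>r s = 1 / sqrt s\<close> satisfies \<open>r' = - r^3 / 2\<close>, so each order of differentiability gives the
  next one. This single function suffices for normalizing vectors.\<close>

lemma Ck_on_inverse_sqrt: "Ck_on k {0<..} (\<lambda>s. inverse (sqrt s))"
proof (induction k)
  case 0
  then show ?case by (auto intro!: continuous_intros)
next
  case (Suc k)
  let ?r = "\<lambda>s::real. inverse (sqrt s)"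
  show ?case
  proof (rule Ck_on_SucI)
    fix s :: real assume "s \<in> {0<..}"
    then show "(?r has_derivative (\<lambda>v. (?r s * (?r s * ?r s)) * (- v / 2))) (at s)"
      by (auto intro!: derivative_eq_intros simp: field_simps)
  next
    show "Ck_on k {0<..} (\<lambda>s. (?r s * (?r s * ?r s)) * (- v / 2))" for v
      by (intro Ck_on_bounded_bilinear[OF _ bounded_bilinear_mult] Suc Ck_on_const) auto
  qed simp
qed

lemma smooth_open_continuous: "smooth_open U f \<Longrightarrow> continuous_on U f"
  unfolding smooth_open_def by (metis Ck_on.simps(1))

lemma smooth_open_has_derivative:
  "smooth_open U f \<Longrightarrow> x \<in> U \<Longrightarrow> (f has_derivative frechet_derivative f (at x)) (at x)"
  unfolding smooth_open_def using Ck_on_SucD(1) by blast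

lemma smooth_open_directional_derivative:
  "smooth_open U f \<Longrightarrow> smooth_open U (\<lambda>x. frechet_derivative f (at x) v)"
  unfolding smooth_open_def using Ck_on_SucD(2) by blast

lemma smooth_open_subset: "smooth_open U f \<Longrightarrow> V \<subseteq> U \<Longrightarrow> smooth_open V f"
  unfolding smooth_open_def using Ck_on_subset by blast

lemma smooth_open_compose:
  fixes f :: "'a::real_normed_vector \<Rightarrow> 'b::euclidean_space"
  assumes "open U" "f ` U \<subseteq> V" "smooth_open U f" "smooth_open V g"
  shows "smooth_open U (\<lambda>x. g (f x))"
  using assms Ck_on_compose unfolding smooth_open_def by blast

lemma smooth_open_bounded_linear:
  assumes "open U" "bounded_linear h" "smooth_open U f"
  shows "smooth_open U (\<lambda>x. h (f x))"
  using assms Ck_on_bounded_linear unfolding smooth_open_def by blast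

lemma smooth_open_add:
  assumes "open U" "smooth_open U f" "smooth_open U g"
  shows "smooth_open U (\<lambda>x. f x + g x)"
  using assms Ck_on_add unfolding smooth_open_def by blast

lemma smooth_open_bounded_bilinear:
  assumes "open U" "bounded_bilinear h" "smooth_open U f" "smooth_open U g"
  shows "smooth_open U (\<lambda>x. h (f x) (g x))"
  using assms Ck_on_bounded_bilinear unfolding smooth_open_def by blast

lemma smooth_on_setI:
  "open U \<Longrightarrow> S \<subseteq> U \<Longrightarrow> smooth_open U g \<Longrightarrow> (\<And>x. x \<in> S \<Longrightarrow> g x = f x) \<Longrightarrow> smooth_on_set S f"
  unfolding smooth_on_set_def smooth_extension_def by blast

lemma smooth_on_set_iff:
  "smooth_on_set S f \<longleftrightarrow>
     (\<exists>U g. open U \<and> S \<subseteq> U \<and> smooth_open U g \<and> (\<forall>x\<in>S. g x = f x))"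
  unfolding smooth_on_set_def smooth_extension_def by blast

lemma smooth_on_set_continuous: "smooth_on_set S f \<Longrightarrow> continuous_on S f"
  unfolding smooth_on_set_iff
  by (metis continuous_on_cong continuous_on_subset smooth_open_continuous)

lemma smooth_on_set_cong:
  "smooth_on_set S g \<Longrightarrow> (\<And>x. x \<in> S \<Longrightarrow> f x = g x) \<Longrightarrow> smooth_on_set S f"
  unfolding smooth_on_set_def smooth_extension_def by metis

lemma smooth_on_set_const: "smooth_on_set S (\<lambda>x. c)"
  by (rule smooth_on_setI[of UNIV]) (auto simp: smooth_open_def Ck_on_const)

lemma smooth_on_set_id: "smooth_on_set S (\<lambda>x. x)"
proof (rule smooth_on_setI[of UNIV])
  have "Ck_on (Suc k) (UNIV::'a set) (\<lambda>x. x)" for k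
    by (intro Ck_on_SucI[where f' = "\<lambda>x v. v"]) (auto simp: Ck_on_const)
  then show "smooth_open UNIV (\<lambda>x::'a. x)"
    unfolding smooth_open_def using Ck_on_lower by blast
qed auto

lemma smooth_on_set_bounded_linear:
  assumes "bounded_linear h" "smooth_on_set S f"
  shows "smooth_on_set S (\<lambda>x. h (f x))"
proof -
  obtain U g where "open U" "S \<subseteq> U" "smooth_open U g" "\<And>x. x \<in> S \<Longrightarrow> g x = f x"
    using assms(2) unfolding smooth_on_set_iff by blast
  then show ?thesis
    using smooth_open_bounded_linear[OF _ assms(1)]
    by (intro smooth_on_setI[of U _ "\<lambda>x. h (g x)"]) auto
qed

lemma smooth_on_set_bounded_bilinear:
  assumes "bounded_bilinear h" "smooth_on_set S f" "smooth_on_set S g"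
  shows "smooth_on_set S (\<lambda>x. h (f x) (g x))"
proof -
  obtain U f' where U: "open U" "S \<subseteq> U" "smooth_open U f'" "\<And>x. x \<in> S \<Longrightarrow> f' x = f x"
    using assms(2) unfolding smooth_on_set_iff by blast
  obtain V g' where V: "open V" "S \<subseteq> V" "smooth_open V g'" "\<And>x. x \<in> S \<Longrightarrow> g' x = g x"
    using assms(3) unfolding smooth_on_set_iff by blast
  have "smooth_open (U \<inter> V) (\<lambda>x. h (f' x) (g' x))"
    using U(1) V(1)
    by (intro smooth_open_bounded_bilinear[OF _ assms(1)] smooth_open_subset[OF U(3)]
          smooth_open_subset[OF V(3)]) auto
  then show ?thesis
    using U V by (intro smooth_on_setI[of "U \<inter> V" _ "\<lambda>x. h (f' x) (g' x)"]) auto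
qed

lemma smooth_on_set_add:
  assumes "smooth_on_set S f" "smooth_on_set S g"
  shows "smooth_on_set S (\<lambda>x. f x + g x)"
proof -
  obtain U f' where U: "open U" "S \<subseteq> U" "smooth_open U f'" "\<And>x. x \<in> S \<Longrightarrow> f' x = f x"
    using assms(1) unfolding smooth_on_set_iff by blast
  obtain V g' where V: "open V" "S \<subseteq> V" "smooth_open V g'" "\<And>x. x \<in> S \<Longrightarrow> g' x = g x"
    using assms(2) unfolding smooth_on_set_iff by blast
  have "smooth_open (U \<inter> V) (\<lambda>x. f' x + g' x)"
    using U(1) V(1)
    by (intro smooth_open_add smooth_open_subset[OF U(3)] smooth_open_subset[OF V(3)]) auto
  then show ?thesis
    using U V by (intro smooth_on_setI[of "U \<inter> V" _ "\<lambda>x. f' x + g' x"]) auto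
qed

lemma smooth_on_set_diff:
  assumes "smooth_on_set S f" "smooth_on_set S g"
  shows "smooth_on_set S (\<lambda>x. f x - g x)"
  using smooth_on_set_add[OF assms(1)
      smooth_on_set_bounded_linear[OF bounded_linear_minus[OF bounded_linear_ident] assms(2)]]
  by simp

lemma smooth_on_set_sum:
  assumes "\<And>i. i \<in> I \<Longrightarrow> smooth_on_set S (f i)"
  shows "smooth_on_set S (\<lambda>x. \<Sum>i\<in>I. f i x)"
  using assms
  by (induction I rule: infinite_finite_induct) (auto intro: smooth_on_set_const smooth_on_set_add)

lemma smooth_on_set_vec:
  fixes f :: "'a::real_normed_vector \<Rightarrow> 'b::euclidean_space^'n"
  assumes "\<And>i. smooth_on_set S (\<lambda>x. f x $ i)"
  shows "smooth_on_set S f"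
proof (rule smooth_on_set_cong)
  have "bounded_linear (axis i :: 'b \<Rightarrow> 'b^'n)" for i
    by (intro linear_conv_bounded_linear[THEN iffD1] linearI)
       (auto simp: vec_eq_iff axis_def)
  then show "smooth_on_set S (\<lambda>x. \<Sum>i\<in>UNIV. axis i (f x $ i))"
    by (rule smooth_on_set_sum[OF smooth_on_set_bounded_linear[OF _ assms]])
  show "f x = (\<Sum>i\<in>UNIV. axis i (f x $ i))" for x
    by (simp add: vec_eq_iff axis_def)
qed

lemma smooth_on_set_compose:
  fixes f :: "'a::real_normed_vector \<Rightarrow> 'b::euclidean_space"
  assumes "smooth_on_set S f" "f ` S \<subseteq> V" "open V" "smooth_open V g"
  shows "smooth_on_set S (\<lambda>x. g (f x))"
proof -
  obtain U f' where U: "open U" "S \<subseteq> U" "smooth_open U f'" "\<And>x. x \<in> S \<Longrightarrow> f' x = f x"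
    using assms(1) unfolding smooth_on_set_iff by blast
  let ?U = "U \<inter> f' -` V"
  have "open ?U"
    using U assms(3) smooth_open_continuous continuous_on_open_vimage
    by (metis inf_commute)
  moreover have "smooth_open ?U (\<lambda>x. g (f' x))"
    by (rule smooth_open_compose[OF \<open>open ?U\<close> _ smooth_open_subset[OF U(3)] assms(4)]) auto
  ultimately show ?thesis
    using U(2,4) assms(2)
    by (intro smooth_on_setI[of ?U _ "\<lambda>x. g (f' x)"]) (auto simp: image_subset_iff)
qed

lemma smooth_on_set_normalize:
  fixes f :: "'a::real_normed_vector \<Rightarrow> 'b::euclidean_space"
  assumes "smooth_on_set S f" "\<And>x. x \<in> S \<Longrightarrow> f x \<noteq> 0"
  shows "smooth_on_set S (\<lambda>x. f x /\<^sub>R norm (f x))"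
proof -
  have "smooth_on_set S (\<lambda>x. inverse (sqrt (f x \<bullet> f x)))"
    using assms
    by (intro smooth_on_set_compose[of S "\<lambda>x. f x \<bullet> f x" "{0<..}" "\<lambda>s. inverse (sqrt s)"]
          smooth_on_set_bounded_bilinear[OF bounded_bilinear_inner])
       (auto simp: smooth_open_def Ck_on_inverse_sqrt)
  from smooth_on_set_bounded_bilinear[OF bounded_bilinear_scaleR this assms(1)]
  show ?thesis by (simp add: norm_eq_sqrt_inner)
qed

section \<open>Tensors\<close>

lemma frob_eq_inner: "A \<Colon> B = A \<bullet> B"
  by (simp add: frob_def trace_def matrix_matrix_mult_def transpose_def inner_vec_def sum_3)

lemma bounded_bilinear_cross3: "bounded_bilinear cross3"
  using bilinear_cross bilinear_conv_bounded_bilinear by blast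

lemma bounded_linear_trace: "bounded_linear (trace :: real^3^3 \<Rightarrow> real)"
  unfolding trace_def
  by (intro bounded_linear_sum bounded_linear_compose[OF bounded_linear_vec_nth bounded_linear_vec_nth])

lemma bounded_linear_transpose: "bounded_linear (transpose :: real^3^3 \<Rightarrow> real^3^3)"
  by (intro linear_conv_bounded_linear[THEN iffD1] linearI) (auto simp: vec_eq_iff transpose_def)

lemma bounded_bilinear_matrix_vector: "bounded_bilinear ((*v) :: real^3^3 \<Rightarrow> real^3 \<Rightarrow> real^3)"
  unfolding bilinear_conv_bounded_bilinear[symmetric] bilinear_def
  by (auto intro!: linearI simp: vec_eq_iff matrix_vector_mult_def sum_3 algebra_simps)

lemma bounded_bilinear_matrix_matrix: "bounded_bilinear ((**) :: real^3^3 \<Rightarrow> real^3^3 \<Rightarrow> real^3^3)"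
  unfolding bilinear_conv_bounded_bilinear[symmetric] bilinear_def
  by (auto intro!: linearI simp: vec_eq_iff matrix_matrix_mult_def sum_3 algebra_simps)

lemma smooth_on_set_nth: "smooth_on_set S f \<Longrightarrow> smooth_on_set S (\<lambda>x. f x $ i)"
  by (rule smooth_on_set_bounded_linear[OF bounded_linear_vec_nth])

lemma smooth_on_set_mult:
  fixes f g :: "'a::real_normed_vector \<Rightarrow> real"
  shows "smooth_on_set S f \<Longrightarrow> smooth_on_set S g \<Longrightarrow> smooth_on_set S (\<lambda>x. f x * g x)"
  by (rule smooth_on_set_bounded_bilinear[OF bounded_bilinear_mult])

lemma smooth_on_set_tangent_proj:
  assumes "smooth_on_set S n"
  shows "smooth_on_set S (\<lambda>x. tangent_proj (n x))"
  unfolding tangent_proj_def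
proof (intro smooth_on_set_diff smooth_on_set_const)
  show "smooth_on_set S (\<lambda>x. \<chi> i j. n x $ i * n x $ j)"
    using smooth_on_set_mult[OF smooth_on_set_nth[OF assms] smooth_on_set_nth[OF assms]]
    by (intro smooth_on_set_vec) simp
qed

lemma smooth_on_set_cof:
  assumes "smooth_on_set S F"
  shows "smooth_on_set S (\<lambda>x. cof (F x))"
proof -
  have entry: "smooth_on_set S (\<lambda>x. F x $ i $ j)" for i j
    by (intro smooth_on_set_nth assms)
  have minor: "smooth_on_set S (\<lambda>x. det (A x))"
    if A: "\<And>k l. smooth_on_set S (\<lambda>x. A x $ k $ l)" for A :: "_ \<Rightarrow> real^3^3"
    unfolding det_3 by (intro smooth_on_set_add smooth_on_set_diff smooth_on_set_mult A)
  have masked: "smooth_on_set S (\<lambda>x. if k = i \<and> l = j then 1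
      else if k = i \<or> l = j then 0 else F x $ k $ l)" for i j k l
    by (cases "k = i \<and> l = j"; cases "k = i \<or> l = j") (auto simp: smooth_on_set_const entry)
  have "smooth_on_set S (\<lambda>x. cof (F x) $ i $ j)" for i j
    unfolding cof_def using minor[of "\<lambda>x. \<chi> k l. if k = i \<and> l = j then 1
      else if k = i \<or> l = j then 0 else F x $ k $ l"] masked by simp
  then show ?thesis by (intro smooth_on_set_vec)
qed

lemma cof_rows:
  "row 1 (cof A) = cross3 (row 2 A) (row 3 A)"
  "row 2 (cof A) = cross3 (row 3 A) (row 1 A)"
  "row 3 (cof A) = cross3 (row 1 A) (row 2 A)"
  by (simp_all add: cof_def det_3 row_def cross3_def vec_eq_iff forall_3)

lemma cross3_perpendicular:
  assumes "norm n = 1" "a \<bullet> n = 0" "b \<bullet> n = 0"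
  shows "cross3 a b = (cross3 a b \<bullet> n) *\<^sub>R n"
proof -
  \<comment> \<open>The tangential part of a vector \<open>c\<close> is \<open>(n \<times> c) \<times> n\<close>, so \<open>n \<times> c = 0\<close> leaves only the normal part.\<close>
  have "cross3 n (cross3 a b) = 0"
    using assms by (simp add: Lagrange inner_commute)
  then have "cross3 (cross3 n (cross3 a b)) n = 0"
    by simp
  moreover have "cross3 (cross3 n c) n = c - (c \<bullet> n) *\<^sub>R n" for c
    using assms(1) unfolding norm_eq_1
    by (simp add: cross3_def vec_eq_iff forall_3 inner_vec_def sum_3) (algebra)
  ultimately show ?thesis by simp
qed

text \<open>The rows of \<open>F\<close> are orthogonal to \<open>n\<close>, hence their cross products, which are the rows of \<open>cof F\<close>, are
  multiples of \<open>n\<close>. If \<open>cof F\<close> annihilates \<open>n\<close>, these multiples vanish: any two rows of \<open>F\<close> are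
  then parallel and the rank is at most one.\<close>

lemma cof_normal_nonzero:
  assumes n: "norm n = 1" and ker: "F *v n = 0" and rank: "rank F = 2"
  shows "cof F *v n \<noteq> 0"
proof
  assume zero: "cof F *v n = 0"
  have perp: "row i F \<bullet> n = 0" for i
    using ker by (metis matrix_vector_mul_component zero_index row_def vec_lambda_eta)
  have "row i (cof F) \<bullet> n = 0" for i
    using zero by (metis matrix_vector_mul_component zero_index row_def vec_lambda_eta)
  then have "cross3 (row 2 F) (row 3 F) \<bullet> n = 0" "cross3 (row 3 F) (row 1 F) \<bullet> n = 0"
    "cross3 (row 1 F) (row 2 F) \<bullet> n = 0"
    unfolding cof_rows[symmetric] by blast+
  then have crosses: "cross3 (row 2 F) (row 3 F) = 0" "cross3 (row 3 F) (row 1 F) = 0"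
    "cross3 (row 1 F) (row 2 F) = 0"
    using cross3_perpendicular[OF n perp perp] by (metis scaleR_zero_left)+
  have skew: "cross3 (row j F) (row i F) = 0" if "cross3 (row i F) (row j F) = 0" for i j
    using that cross_skew[of "row j F" "row i F"] by simp
  have *: "cross3 (row i F) (row j F) = 0" for i j
    using exhaust_3[of i] exhaust_3[of j] crosses crosses[THEN skew] by auto
  obtain r where r: "rows F \<subseteq> span {r}"
  proof (cases "\<forall>i. row i F = 0")
    case True
    then show ?thesis by (intro that[of 0]) (auto simp: rows_def)
  next
    case False
    then obtain i where i: "row i F \<noteq> 0" by blast
    have "row j F \<in> span {row i F}" for j
      using *[of i j] i unfolding cross_eq_0 collinear_lemma
      by (auto simp: span_singleton)
    then show ?thesis by (intro that[of "row i F"]) (auto simp: rows_def)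
  qed
  have "dim (rows F) \<le> card {r}"
    by (rule dim_le_card[OF r]) simp
  then show False using rank by (simp add: row_rank_def)
qed

section \<open>Regularity of surface elements and deformations\<close>

lemma compact_ref_dom: "compact (ref_dom e)"
  unfolding ref_dom_def by (intro compact_convex_hull finite_imp_compact) simp

lemma convex_ref_dom: "convex (ref_dom e)"
  unfolding ref_dom_def by simp

text \<open>Both reference domains contain the standard simplex of the plane.\<close>

lemma interior_ref_dom_nonempty: "interior (ref_dom e) \<noteq> {}"
proof -
  have "insert 0 Basis \<subseteq> set (ref_vertices s)" for s
    by (cases s) (auto simp: Basis_vec_def forall_2 UNIV_2 axis_eq_axis)
  then have "convex hull (insert 0 Basis) \<subseteq> ref_dom e"
    unfolding ref_dom_def by (intro hull_mono)
  then have "interior (convex hull (insert 0 Basis)) \<subseteq> interior (ref_dom e)"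
    by (rule interior_mono)
  moreover obtain a :: "real^2" where "a \<in> interior (convex hull (insert 0 Basis))"
    by (rule interior_std_simplex_nonempty)
  ultimately show ?thesis by blast
qed

lemma closure_interior_ref_dom: "closure (interior (ref_dom e)) = ref_dom e"
  using convex_closure_interior[OF convex_ref_dom interior_ref_dom_nonempty]
  by (simp add: compact_ref_dom compact_imp_closed)

lemma surface_elementE:
  assumes "surface_element e"
  obtains W where "open W" "ref_dom e \<subseteq> W" "smooth_open W (elt_map e)"
  using assms unfolding surface_element_def by blast

lemma elt_coord_elt_map:
  assumes "surface_element e" "y \<in> ref_dom e"
  shows "elt_coord e (elt_map e y) = y"
  using assms unfolding surface_element_def elt_coord_def by (simp add: inv_into_f_f)

lemma elt_coord_in_ref_dom: "x \<in> elt_set e \<Longrightarrow> elt_coord e x \<in> ref_dom e"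
  unfolding elt_set_def elt_coord_def by (rule inv_into_into)

text \<open>A smooth extension \<open>g\<close> of the coordinates satisfies \<open>g \<circ> elt_map e = id\<close> on the reference domain. In the
  interior this can be differentiated, and the identity \<open>Dg \<circ> D(elt_map e) = id\<close> extends to
  the boundary by continuity.\<close>

lemma elt_map_derivative_injective:
  assumes e: "surface_element e" and y: "y \<in> ref_dom e"
    and v: "frechet_derivative (elt_map e) (at y) v = 0"
  shows "v = 0"
proof -
  obtain W where W: "open W" "ref_dom e \<subseteq> W" "smooth_open W (elt_map e)"
    using e by (rule surface_elementE)
  obtain U g where U: "open U" "elt_set e \<subseteq> U" "smooth_open U g" "\<forall>x\<in>elt_set e. g x = elt_coord e x"
    using e unfolding surface_element_def smooth_on_set_iff by blast
  let ?V = "W \<inter> elt_map e -` U" and ?h = "\<lambda>z. g (elt_map e z)"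
  have V: "open ?V"
    using W U(1) smooth_open_continuous continuous_on_open_vimage by (metis inf_commute)
  have sub: "ref_dom e \<subseteq> ?V"
    using W(2) U(2) unfolding elt_set_def by blast
  have h: "smooth_open ?V ?h"
    by (rule smooth_open_compose[OF V _ smooth_open_subset[OF W(3)] U(3)]) auto
  have h_id: "?h z = z" if "z \<in> ref_dom e" for z
    using that U(4) elt_coord_elt_map[OF e that] by (simp add: elt_set_def)
  have "frechet_derivative ?h (at z) v = v" if "z \<in> interior (ref_dom e)" for z
  proof -
    have "(?h has_derivative (\<lambda>w. w)) (at z)"
      by (rule has_derivative_eq_on_open[OF open_interior that, of _ "\<lambda>z. z"])
         (use h_id interior_subset in auto)
    then show ?thesis
      using frechet_derivative_at by metis
  qed
  moreover have "continuous_on (closure (interior (ref_dom e))) (\<lambda>z. frechet_derivative ?h (at z) v)"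
    unfolding closure_interior_ref_dom
    by (rule continuous_on_subset[OF smooth_open_continuous[OF
          smooth_open_directional_derivative[OF h]] sub])
  ultimately have h_fixes: "frechet_derivative ?h (at y) v = v"
    using continuous_constant_on_closure[of "interior (ref_dom e)"
        "\<lambda>z. frechet_derivative ?h (at z) v" v y] y
    by (simp only: closure_interior_ref_dom)
  have chain: "(?h has_derivative (\<lambda>w. frechet_derivative g (at (elt_map e y))
                    (frechet_derivative (elt_map e) (at y) w))) (at y)"
    using y sub
    by (intro has_derivative_compose[OF smooth_open_has_derivative[OF W(3)]
          smooth_open_has_derivative[OF U(3)]]) auto
  have "frechet_derivative g (at (elt_map e y)) 0 = 0"
    using y sub
    by (intro linear_0[OF has_derivative_linear[OF smooth_open_has_derivative[OF U(3)]]]) auto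
  then show ?thesis
    using h_fixes v frechet_derivative_at[OF chain] by metis
qed

text \<open>If the cross product of the two tangent vectors vanishes, they are linearly dependent, and the derivative
  annihilates a nonzero vector of the parameter plane.\<close>

lemma area_vector_nonzero:
  assumes e: "surface_element e" and y: "y \<in> ref_dom e"
  shows "area_vector e y \<noteq> 0"
proof
  let ?D = "frechet_derivative (elt_map e) (at y)"
  let ?a = "axis 1 1 :: real^2" and ?b = "axis 2 1 :: real^2"
  have lin: "linear ?D"
    using e y smooth_open_has_derivative has_derivative_linear
    by (metis surface_elementE subsetD)
  assume "area_vector e y = 0"
  then consider "?D ?a = 0" | c where "?D ?b = c *\<^sub>R ?D ?a"
    unfolding area_vector_def cross_eq_0 collinear_lemma by (metis scaleR_zero_left)
  then show False
  proof cases
    case 1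
    then show False
      using elt_map_derivative_injective[OF e y, of ?a] by (simp add: axis_eq_0_iff)
  next
    case 2
    then have "?D (?b - c *\<^sub>R ?a) = 0"
      by (simp add: linear_diff[OF lin] linear_scale[OF lin])
    then have "?b - c *\<^sub>R ?a = 0"
      by (rule elt_map_derivative_injective[OF e y])
    then have "(?b - c *\<^sub>R ?a) $ 2 = 0"
      by (simp only: zero_index)
    then show False by (simp add: axis_def)
  qed
qed

lemma area_vector_smooth:
  assumes "open W" "smooth_open W (elt_map e)"
  shows "smooth_open W (area_vector e)"
  unfolding area_vector_def
  by (intro smooth_open_bounded_bilinear[OF assms(1) bounded_bilinear_cross3]
        smooth_open_directional_derivative assms(2))

lemma elt_normal_smooth:
  assumes e: "surface_element e"
  shows "smooth_on_set (elt_set e) (elt_normal e)"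
proof -
  obtain W where W: "open W" "ref_dom e \<subseteq> W" "smooth_open W (elt_map e)"
    using e by (rule surface_elementE)
  have "smooth_on_set (elt_set e) (\<lambda>x. area_vector e (elt_coord e x))"
    using e W elt_coord_in_ref_dom
    by (intro smooth_on_set_compose[OF _ _ W(1) area_vector_smooth]) (auto simp: surface_element_def)
  then show ?thesis
    unfolding elt_normal_def Let_def
    using area_vector_nonzero[OF e] elt_coord_in_ref_dom by (intro smooth_on_set_normalize) auto
qed

lemma norm_elt_normal:
  assumes "surface_element e" "x \<in> elt_set e"
  shows "norm (elt_normal e x) = 1"
  using area_vector_nonzero[OF assms(1) elt_coord_in_ref_dom[OF assms(2)]]
  by (simp add: elt_normal_def Let_def)

lemma gradient_smooth:
  assumes "open U" "S \<subseteq> U" "smooth_open U f"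
  shows "smooth_on_set S (gradient f)"
  unfolding gradient_def
  using smooth_on_setI[OF assms(1,2) smooth_open_directional_derivative[OF assms(3)] refl]
  by (intro smooth_on_set_vec) simp

text \<open>The extension picked in the definition of the surface gradient exists because \<open>f\<close> is smooth, and it
  is smooth on a whole neighbourhood, hence so is its gradient.\<close>

lemma surf_grad_smooth:
  assumes e: "surface_element e" and f: "smooth_on_set (elt_set e) f"
  shows "smooth_on_set (elt_set e) (surf_grad e f)"
proof -
  let ?f = "SOME f'. smooth_extension (elt_set e) f f'"
  have "smooth_extension (elt_set e) f ?f"
    using f unfolding smooth_on_set_def by (rule someI_ex)
  then have "smooth_on_set (elt_set e) (gradient ?f)"
    unfolding smooth_extension_def using gradient_smooth by blast
  then show ?thesis
    unfolding surf_grad_def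
    by (intro smooth_on_set_bounded_bilinear[OF bounded_bilinear_matrix_vector]
          smooth_on_set_tangent_proj elt_normal_smooth e)
qed

lemma surf_jac_smooth:
  assumes "surface_element e" "smooth_on_set (elt_set e) v"
  shows "smooth_on_set (elt_set e) (surf_jac e v)"
  unfolding surf_jac_def
  using surf_grad_smooth[OF assms(1) smooth_on_set_nth[OF assms(2)]]
  by (intro smooth_on_set_vec) (simp add: smooth_on_set_nth)

lemma tangent_proj_symtan:
  assumes "norm n = 1"
  shows "tangent_proj n \<in> symtan n"
proof -
  have "n $ 1 * n $ 1 + n $ 2 * n $ 2 + n $ 3 * n $ 3 = 1"
    using assms unfolding norm_eq_1 by (simp add: inner_vec_def sum_3)
  then show ?thesis
    unfolding symtan_def tangent_proj_def
    by (simp add: vec_eq_iff transpose_def matrix_vector_mult_def mat_def sum_3 forall_3) algebra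
qed

text \<open>The rows of a surface Jacobian are tangential, so the normal lies in its kernel.\<close>

lemma surf_jac_normal:
  assumes "surface_element e" "x \<in> elt_set e"
  shows "surf_jac e v x *v elt_normal e x = 0"
proof -
  let ?P = "tangent_proj (elt_normal e x)"
  have P: "transpose ?P = ?P" "?P *v elt_normal e x = 0"
    using tangent_proj_symtan[OF norm_elt_normal[OF assms]] by (auto simp: symtan_def)
  have "(?P *v w) \<bullet> elt_normal e x = 0" for w
    using P by (metis dot_lmul_matrix inner_zero_right vector_transpose_matrix)
  then show ?thesis
    by (simp add: vec_eq_iff matrix_vector_mul_component surf_jac_def surf_grad_def)
qed

lemma deform_grad_smooth:
  assumes "surface_element e" "smooth_on_set (elt_set e) u"
  shows "smooth_on_set (elt_set e) (deform_grad u e)"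
  unfolding deform_grad_def
  by (intro surf_jac_smooth smooth_on_set_add smooth_on_set_id assms)

lemma deformed_normal_smooth:
  assumes e: "surface_element e" and u: "smooth_on_set (elt_set e) u"
    and rank: "\<And>x. x \<in> elt_set e \<Longrightarrow> rank (deform_grad u e x) = 2"
  shows "smooth_on_set (elt_set e) (deformed_normal u e)"
  unfolding deformed_normal_def Let_def
proof (rule smooth_on_set_normalize)
  show "smooth_on_set (elt_set e) (\<lambda>x. cof (deform_grad u e x) *v elt_normal e x)"
    by (intro smooth_on_set_bounded_bilinear[OF bounded_bilinear_matrix_vector]
          smooth_on_set_cof deform_grad_smooth elt_normal_smooth e u)
  show "cof (deform_grad u e x) *v elt_normal e x \<noteq> 0" if "x \<in> elt_set e" for x
    using cof_normal_nonzero[OF norm_elt_normal[OF e that] _ rank[OF that]]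
      surf_jac_normal[OF e that] by (simp add: deform_grad_def)
qed

lemma curvature_diff_smooth:
  assumes e: "surface_element e" and u: "smooth_on_set (elt_set e) u"
    and rank: "\<And>x. x \<in> elt_set e \<Longrightarrow> rank (deform_grad u e x) = 2"
  shows "smooth_on_set (elt_set e) (curvature_diff u e)"
  unfolding curvature_diff_def
  by (intro smooth_on_set_diff smooth_on_set_bounded_bilinear[OF bounded_bilinear_matrix_matrix]
        smooth_on_set_bounded_linear[OF bounded_linear_transpose]
        deform_grad_smooth surf_jac_smooth deformed_normal_smooth elt_normal_smooth assms)

section \<open>The material law\<close>

lemma subspace_symtan: "subspace (symtan n)"
proof -
  note t = bounded_linear.linear[OF bounded_linear_transpose]
  show ?thesis
    unfolding subspace_def symtan_def
    by (auto simp: linear_0[OF t] linear_add[OF t] linear_scale[OF t]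
        matrix_vector_mult_add_rdistrib scaleR_matrix_vector_assoc[symmetric])
qed

lemma tangent_proj_frob:
  assumes "A \<in> symtan n"
  shows "tangent_proj n \<Colon> A = trace A"
proof -
  have "n \<bullet> (A *v n) = 0" using assms by (simp add: symtan_def)
  then show ?thesis
    by (simp add: frob_eq_inner tangent_proj_def inner_vec_def mat_def trace_def sum_3
        matrix_vector_mult_def algebra_simps)
qed

lemma trace_tangent_proj:
  assumes "norm n = 1"
  shows "trace (tangent_proj n) = 2"
  using assms unfolding norm_eq_1
  by (simp add: tangent_proj_def trace_def mat_def inner_vec_def sum_3)

lemma trace_linear:
  fixes A B :: "real^3^3"
  shows "trace (A + B) = trace A + trace B" "trace (A - B) = trace A - trace B"
    "trace (c *\<^sub>R A) = c * trace A"
  by (simp_all add: trace_def sum_3 algebra_simps)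

text \<open>By polarization the quadratic form determines \<open>M n A : B\<close> for all \<open>B\<close>. The difference of both sides
  is symmetric tangential and orthogonal to all symmetric tangential tensors, hence zero.\<close>

lemma material_tensor_formula:
  assumes M: "material_tensor Y p M" and n: "norm n = 1" and A: "A \<in> symtan n"
  shows "M n A = (Y / (1 - p^2)) *\<^sub>R ((p * trace A) *\<^sub>R tangent_proj n + (1 - p) *\<^sub>R A)"
    (is "_ = ?N A")
proof -
  note sub = subspace_symtan[of n]
  have maps: "M n B \<in> symtan n" if "B \<in> symtan n" for B
    using M n that unfolding material_tensor_def by blast
  have add: "M n (B + C) = M n B + M n C" if "B \<in> symtan n" "C \<in> symtan n" for B C
    using M n that unfolding material_tensor_def by blast
  have sym: "M n B \<bullet> C = M n C \<bullet> B" if "B \<in> symtan n" "C \<in> symtan n" for B C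
    using M n that unfolding material_tensor_def frob_eq_inner by (metis inner_commute)
  have sq: "M n B \<bullet> B = Y / (1 - p^2) * (p * (trace B)^2 + (1 - p) * (B \<bullet> B))"
    if "B \<in> symtan n" for B
    using M n that unfolding material_tensor_def frob_eq_inner by blast
  have N: "?N A \<in> symtan n"
    by (intro subspace_scale[OF sub] subspace_add[OF sub] A tangent_proj_symtan n)
  have weak: "(M n A - ?N A) \<bullet> B = 0" if B: "B \<in> symtan n" for B
  proof -
    have "M n (A + B) \<bullet> (A + B) = M n A \<bullet> A + 2 * (M n A \<bullet> B) + M n B \<bullet> B"
      using sym[OF A B] by (simp add: add[OF A B] inner_add_left inner_add_right)
    then have "2 * (M n A \<bullet> B) = 2 * (Y / (1 - p^2) * (p * trace A * trace B + (1 - p) * (A \<bullet> B)))"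
      unfolding sq[OF A] sq[OF B] sq[OF subspace_add[OF sub A B]]
      by (simp add: trace_linear inner_add_left inner_add_right inner_commute[of B A]
          power2_eq_square algebra_simps)
    moreover have "?N A \<bullet> B = Y / (1 - p^2) * (p * trace A * trace B + (1 - p) * (A \<bullet> B))"
      using tangent_proj_frob[OF B] by (simp add: frob_eq_inner inner_add_left)
    ultimately show ?thesis by (simp only: inner_diff_left)
  qed
  have "M n A - ?N A \<in> symtan n"
    by (intro subspace_diff[OF sub] maps A N)
  then have "(M n A - ?N A) \<bullet> (M n A - ?N A) = 0"
    by (rule weak)
  then show ?thesis unfolding inner_eq_zero_iff by (simp only: right_minus_eq)
qed

text \<open>The tangential projection is an eigenvector of \<open>M\<close> to the eigenvalue \<open>Y / (1 - p^2) * (1 + p)\<close>, which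
  invertibility requires to be nonzero. With \<open>x / 0 = 0\<close> this also excludes \<open>p^2 = 1\<close>.\<close>

lemma invertible_material_moduli:
  assumes M: "material_tensor Y p M" and inv: "invertible_material M"
  shows "Y \<noteq> 0" "p \<noteq> 1" "p \<noteq> -1"
proof -
  define n :: "real^3" where "n = axis 1 1"
  have n: "norm n = 1" by (simp add: n_def)
  let ?P = "tangent_proj n"
  have P: "?P \<in> symtan n" by (rule tangent_proj_symtan[OF n])
  have zero: "0 \<in> symtan n" by (rule subspace_0[OF subspace_symtan])
  have "(p * 2) *\<^sub>R ?P + (1 - p) *\<^sub>R ?P = (1 + p) *\<^sub>R ?P"
    by (simp add: scaleR_add_left[symmetric])
  then have MP: "M n ?P = (Y / (1 - p^2) * (1 + p)) *\<^sub>R ?P"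
    unfolding material_tensor_formula[OF M n P] trace_tangent_proj[OF n] by simp
  have M0: "M n 0 = 0"
    using material_tensor_formula[OF M n zero] by (simp add: trace_def)
  have "inj_on (M n) (symtan n)"
    using inv n unfolding invertible_material_def bij_betw_def by blast
  moreover have "?P \<noteq> 0"
    using trace_tangent_proj[OF n] by (auto simp: trace_def)
  ultimately have "M n ?P \<noteq> M n 0"
    using P zero by (auto dest: inj_onD)
  then have "Y / (1 - p^2) * (1 + p) \<noteq> 0"
    using MP M0 by auto
  then show "Y \<noteq> 0" "p \<noteq> 1" "p \<noteq> -1" by auto
qed

lemma material_inverse_formula:
  assumes M: "material_tensor Y p M" and inv: "invertible_material M"
    and n: "norm n = 1" and A: "A \<in> symtan n"
  shows "material_inverse M n A = (1 / Y) *\<^sub>R ((1 + p) *\<^sub>R A - (p * trace A) *\<^sub>R tangent_proj n)"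
    (is "_ = ?K")
proof -
  note ne = invertible_material_moduli[OF M inv] and sub = subspace_symtan[of n]
  have K: "?K \<in> symtan n"
    by (intro subspace_scale[OF sub] subspace_diff[OF sub] A tangent_proj_symtan n)
  have trK: "trace ?K = (1 - p) / Y * trace A"
  proof -
    have "(1 + p) * trace A - p * trace A * 2 = (1 - p) * trace A" by algebra
    then show ?thesis by (simp add: trace_linear trace_tangent_proj[OF n])
  qed
  have pp: "1 - p^2 = (1 - p) * (1 + p)" by algebra
  define c where "c = (1 - p) / Y"
  have "(p * trace ?K) *\<^sub>R tangent_proj n + (1 - p) *\<^sub>R ?K
      = (p * (c * trace A)) *\<^sub>R tangent_proj n
        + c *\<^sub>R ((1 + p) *\<^sub>R A - (p * trace A) *\<^sub>R tangent_proj n)"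
    unfolding trK c_def by simp
  also have "\<dots> = (c * (1 + p)) *\<^sub>R A"
    by (simp add: scaleR_diff_right mult.left_commute)
  also have "c * (1 + p) = (1 - p^2) / Y"
    by (simp add: c_def pp)
  finally have "(p * trace ?K) *\<^sub>R tangent_proj n + (1 - p) *\<^sub>R ?K = ((1 - p^2) / Y) *\<^sub>R A" .
  moreover have "1 - p^2 \<noteq> 0" using ne unfolding pp by auto
  ultimately have "M n ?K = A"
    unfolding material_tensor_formula[OF M n K] using ne by simp
  moreover have "inj_on (M n) (symtan n)"
    using inv n unfolding invertible_material_def bij_betw_def by blast
  ultimately show ?thesis
    unfolding material_inverse_def using K by (metis inv_into_f_eq)
qed

lemma sqnorm_material_inverse:
  assumes M: "material_tensor Y p M" and inv: "invertible_material M"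
    and n: "norm n = 1" and A: "A \<in> symtan n"
  shows "sqnorm (material_inverse M) n A = (1 + p) / Y * (A \<Colon> A - p / (p + 1) * (trace A)^2)"
proof -
  have "1 + p \<noteq> 0" using invertible_material_moduli(3)[OF M inv] by linarith
  moreover have "sqnorm (material_inverse M) n A = 1 / Y * ((1 + p) * (A \<Colon> A) - p * (trace A)^2)"
    using tangent_proj_frob[OF A]
    by (simp add: sqnorm_def material_inverse_formula[OF assms] frob_eq_inner inner_diff_left
        power2_eq_square)
  ultimately show ?thesis
    by (simp add: right_diff_distrib add.commute)
qed

lemma material_inverse_symtan:
  assumes "invertible_material M" "norm n = 1" "A \<in> symtan n"
  shows "material_inverse M n A \<in> symtan n" "M n (material_inverse M n A) = A"
proof -
  have "bij_betw (M n) (symtan n) (symtan n)"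
    using assms unfolding invertible_material_def by blast
  then have A: "A \<in> M n ` symtan n" using assms(3) by (simp add: bij_betw_def)
  show "material_inverse M n A \<in> symtan n" "M n (material_inverse M n A) = A"
    unfolding material_inverse_def using inv_into_into[OF A] f_inv_into_f[OF A] by auto
qed

section \<open>Smooth symmetric tangential fields\<close>

lemma smooth_on_set_frob:
  "smooth_on_set S A \<Longrightarrow> smooth_on_set S B \<Longrightarrow> smooth_on_set S (\<lambda>x. A x \<Colon> B x)"
  unfolding frob_eq_inner by (rule smooth_on_set_bounded_bilinear[OF bounded_bilinear_inner])

lemma smooth_on_set_scaleR:
  "smooth_on_set S c \<Longrightarrow> smooth_on_set S f \<Longrightarrow> smooth_on_set S (\<lambda>x. c x *\<^sub>R f x)"
  by (rule smooth_on_set_bounded_bilinear[OF bounded_bilinear_scaleR])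

text \<open>Covers the material tensor and its inverse at once: both are linear combinations of the tensor
  itself and of the tangential projection weighted by its trace.\<close>

lemma symtan_field_isotropic:
  assumes T: "\<And>e. e \<in> \<T> \<Longrightarrow> surface_element e" and \<kappa>: "symtan_field \<T> \<kappa>"
    and N: "\<And>n A. norm n = 1 \<Longrightarrow> A \<in> symtan n \<Longrightarrow> N n A = (a * trace A) *\<^sub>R tangent_proj n + b *\<^sub>R A"
  shows "symtan_field \<T> (\<lambda>e x. N (elt_normal e x) (\<kappa> e x))"
  unfolding symtan_field_def
proof (intro ballI conjI)
  fix e assume e: "e \<in> \<T>"
  then have \<kappa>e: "smooth_on_set (elt_set e) (\<kappa> e)"
    and sym: "\<And>x. x \<in> elt_set e \<Longrightarrow> \<kappa> e x \<in> symtan (elt_normal e x)"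
    using \<kappa> unfolding symtan_field_def by auto
  note N' = N[OF norm_elt_normal[OF T[OF e]] sym]
  have "smooth_on_set (elt_set e)
     (\<lambda>x. (a * trace (\<kappa> e x)) *\<^sub>R tangent_proj (elt_normal e x) + b *\<^sub>R \<kappa> e x)"
    by (intro smooth_on_set_add smooth_on_set_scaleR smooth_on_set_mult smooth_on_set_const
        smooth_on_set_bounded_linear[OF bounded_linear_trace] smooth_on_set_tangent_proj
        elt_normal_smooth T e \<kappa>e)
  then show "smooth_on_set (elt_set e) (\<lambda>x. N (elt_normal e x) (\<kappa> e x))"
    by (rule smooth_on_set_cong) (rule N')
  show "N (elt_normal e x) (\<kappa> e x) \<in> symtan (elt_normal e x)" if "x \<in> elt_set e" for x
    unfolding N'[OF that that]
    by (intro subspace_add[OF subspace_symtan] subspace_scale[OF subspace_symtan]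
        tangent_proj_symtan norm_elt_normal T e sym that)
qed

lemma symtan_field_material:
  assumes "\<And>e. e \<in> \<T> \<Longrightarrow> surface_element e" "material_tensor Y p M" "symtan_field \<T> \<kappa>"
  shows "symtan_field \<T> (\<lambda>e x. M (elt_normal e x) (\<kappa> e x))"
proof (rule symtan_field_isotropic[OF assms(1,3)])
  show "M n A = (Y / (1 - p^2) * p * trace A) *\<^sub>R tangent_proj n + (Y / (1 - p^2) * (1 - p)) *\<^sub>R A"
    if "norm n = 1" "A \<in> symtan n" for n A
    using material_tensor_formula[OF assms(2) that] by (simp add: scaleR_add_right mult.assoc)
qed

lemma symtan_field_material_inverse:
  assumes "\<And>e. e \<in> \<T> \<Longrightarrow> surface_element e" "material_tensor Y p M" "invertible_material M"
    "symtan_field \<T> \<kappa>"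
  shows "symtan_field \<T> (\<lambda>e x. material_inverse M (elt_normal e x) (\<kappa> e x))"
proof (rule symtan_field_isotropic[OF assms(1,4)])
  show "material_inverse M n A = (- p / Y * trace A) *\<^sub>R tangent_proj n + ((1 + p) / Y) *\<^sub>R A"
    if "norm n = 1" "A \<in> symtan n" for n A
    using material_inverse_formula[OF assms(2,3) that] by (simp add: scaleR_diff_right)
qed

lemma symtan_field_scaleR: "symtan_field \<T> \<kappa> \<Longrightarrow> symtan_field \<T> (\<lambda>e x. c *\<^sub>R \<kappa> e x)"
  unfolding symtan_field_def
  using smooth_on_set_scaleR[OF smooth_on_set_const] subspace_scale[OF subspace_symtan] by blast

lemma symtan_field_diff:
  "symtan_field \<T> \<kappa> \<Longrightarrow> symtan_field \<T> \<sigma> \<Longrightarrow> symtan_field \<T> (\<lambda>e x. \<kappa> e x - \<sigma> e x)"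
  unfolding symtan_field_def
  using smooth_on_set_diff subspace_diff[OF subspace_symtan] by blast

section \<open>Integration over elements\<close>

lemma elt_integrand_continuous:
  assumes e: "surface_element e" and f: "continuous_on (elt_set e) f"
  shows "continuous_on (ref_dom e) (\<lambda>y. f (elt_map e y) * norm (area_vector e y))"
proof -
  obtain W where W: "open W" "ref_dom e \<subseteq> W" "smooth_open W (elt_map e)"
    using e by (rule surface_elementE)
  show ?thesis
  proof (intro continuous_on_mult continuous_on_norm)
    have "continuous_on (ref_dom e) (elt_map e)"
      using smooth_open_continuous[OF W(3)] W(2) continuous_on_subset by blast
    then show "continuous_on (ref_dom e) (\<lambda>y. f (elt_map e y))"
      by (intro continuous_on_compose2[OF f]) (auto simp: elt_set_def)
    show "continuous_on (ref_dom e) (area_vector e)"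
      using smooth_open_continuous[OF area_vector_smooth[OF W(1,3)]] W(2) continuous_on_subset by blast
  qed
qed

lemma elt_integrable:
  assumes "surface_element e" "continuous_on (elt_set e) f"
  shows "set_integrable lborel (ref_dom e) (\<lambda>y. f (elt_map e y) * norm (area_vector e y))"
  unfolding set_integrable_def
  by (rule borel_integrable_compact[OF compact_ref_dom elt_integrand_continuous[OF assms]])

lemma elt_integral_cong:
  assumes "\<And>x. x \<in> elt_set e \<Longrightarrow> f x = g x"
  shows "elt_integral e f = elt_integral e g"
  unfolding elt_integral_def set_lebesgue_integral_def
  using assms by (intro Bochner_Integration.integral_cong) (auto simp: elt_set_def indicator_def)

lemma elt_integral_nonneg:
  assumes "\<And>x. x \<in> elt_set e \<Longrightarrow> 0 \<le> f x"
  shows "0 \<le> elt_integral e f"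
  unfolding elt_integral_def set_lebesgue_integral_def
  using assms by (intro integral_nonneg_AE) (auto simp: elt_set_def indicator_def)

text \<open>A continuous nonnegative function with zero integral vanishes on the closure of an open set whose
  boundary is a null set. The reference domain is of this kind, being convex with nonempty interior, and
  the area density can be divided out.\<close>

lemma elt_integral_eq_0_imp:
  assumes e: "surface_element e" and f: "continuous_on (elt_set e) f"
    and nonneg: "\<And>x. x \<in> elt_set e \<Longrightarrow> 0 \<le> f x" and zero: "elt_integral e f = 0"
    and x: "x \<in> elt_set e"
  shows "f x = 0"
proof -
  let ?h = "\<lambda>y. f (elt_map e y) * norm (area_vector e y)" and ?S = "interior (ref_dom e)"
  note cl = closure_interior_ref_dom[of e]
  have bounded: "bounded ?S"
    using compact_ref_dom compact_imp_bounded bounded_interior by blast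
  have int: "(?h has_integral 0) (ref_dom e)"
    using set_borel_integral_eq_integral[OF elt_integrable[OF e f]] zero
    unfolding elt_integral_def by (metis has_integral_integral)
  have "emeasure lborel (frontier (ref_dom e)) = 0"
    using negligible_convex_frontier[OF convex_ref_dom] frontier_closed
    by (simp add: negligible_iff_null_sets null_sets_completion_iff null_setsD1)
  moreover have "ref_dom e = ?S \<union> frontier (ref_dom e)"
    using interior_subset compact_imp_closed[OF compact_ref_dom, of e]
    by (auto simp: frontier_def)
  ultimately have regular: "emeasure lborel (ref_dom e) = emeasure lborel ?S"
    by (metis borel_open emeasure_Un_null_set frontier_closed borel_closed null_setsI
        open_interior sets_lborel)
  have "?h y = 0" if "y \<in> ref_dom e" for y
  proof (rule has_integral_0_closure_imp_0[of ?S ?h])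
    show "continuous_on (closure ?S) ?h"
      unfolding cl by (rule elt_integrand_continuous[OF e f])
    show "0 \<le> ?h z" if "z \<in> ?S" for z
      using that nonneg[of "elt_map e z"] interior_subset[of "ref_dom e"]
      by (auto simp: elt_set_def intro!: mult_nonneg_nonneg)
    show "0 < emeasure lborel ?S"
      using open_not_negligible[OF open_interior interior_ref_dom_nonempty]
      by (auto simp: zero_less_iff_neq_zero negligible_iff_null_sets null_sets_completion_iff
          null_sets_def)
    show "emeasure lborel ?S < \<infinity>"
      using bounded by (rule emeasure_bounded_finite)
  qed (use regular int that in \<open>simp_all add: cl\<close>)
  moreover obtain y where "y \<in> ref_dom e" "x = elt_map e y"
    using x by (auto simp: elt_set_def)
  ultimately show ?thesis using area_vector_nonzero[OF e] by auto
qed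

lemma surf_integral_cong:
  "(\<And>e x. e \<in> \<T> \<Longrightarrow> x \<in> elt_set e \<Longrightarrow> f e x = g e x) \<Longrightarrow> surf_integral \<T> f = surf_integral \<T> g"
  unfolding surf_integral_def by (intro sum.cong elt_integral_cong) auto

lemma surf_integral_add:
  assumes T: "\<And>e. e \<in> \<T> \<Longrightarrow> surface_element e"
    and "\<And>e. e \<in> \<T> \<Longrightarrow> smooth_on_set (elt_set e) (f e)"
    and "\<And>e. e \<in> \<T> \<Longrightarrow> smooth_on_set (elt_set e) (g e)"
  shows "surf_integral \<T> (\<lambda>e x. f e x + g e x) = surf_integral \<T> f + surf_integral \<T> g"
proof -
  have "elt_integral e (\<lambda>x. f e x + g e x) = elt_integral e (f e) + elt_integral e (g e)"
    if "e \<in> \<T>" for e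
    unfolding elt_integral_def distrib_right
    using that by (intro set_integral_add elt_integrable smooth_on_set_continuous assms)
  then show ?thesis
    unfolding surf_integral_def by (simp add: sum.distrib)
qed

lemma surf_integral_cmult: "surf_integral \<T> (\<lambda>e x. c * f e x) = c * surf_integral \<T> f"
proof -
  have "elt_integral e (\<lambda>x. c * f e x) = c * elt_integral e (f e)" for e
    unfolding elt_integral_def mult.assoc by (rule set_integral_mult_right)
  then show ?thesis unfolding surf_integral_def by (simp add: sum_distrib_left)
qed

lemma surf_integral_eq_0_imp:
  assumes "finite \<T>" and T: "\<And>e. e \<in> \<T> \<Longrightarrow> surface_element e"
    and f: "\<And>e. e \<in> \<T> \<Longrightarrow> smooth_on_set (elt_set e) (f e)"
    and nonneg: "\<And>e x. e \<in> \<T> \<Longrightarrow> x \<in> elt_set e \<Longrightarrow> 0 \<le> f e x"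
    and zero: "surf_integral \<T> f = 0" and e: "e \<in> \<T>" and x: "x \<in> elt_set e"
  shows "f e x = 0"
proof -
  have "elt_integral e (f e) = 0"
    using zero e unfolding surf_integral_def
    by (subst (asm) sum_nonneg_eq_0_iff) (auto intro: elt_integral_nonneg nonneg assms(1))
  then show ?thesis
    using elt_integral_eq_0_imp[OF T[OF e] smooth_on_set_continuous[OF f[OF e]] nonneg[OF e]] x
    by blast
qed


section \<open>Elimination of the curvature\<close>

definition curvature_residual ::
  "(real^3 \<Rightarrow> real^3^3 \<Rightarrow> real^3^3) \<Rightarrow> real \<Rightarrow> (element \<Rightarrow> real^3 \<Rightarrow> real^3^3) \<Rightarrow>
   (element \<Rightarrow> real^3 \<Rightarrow> real^3^3) \<Rightarrow> element \<Rightarrow> real^3 \<Rightarrow> real^3^3" where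
  "curvature_residual M t \<kappa> \<sigma> e x = (t^3 / 12) *\<^sub>R M (elt_normal e x) (\<kappa> e x) - \<sigma> e x"

lemma symtan_field_curvature_residual:
  assumes "\<And>e. e \<in> \<T> \<Longrightarrow> surface_element e" "material_tensor Y p M"
    "symtan_field \<T> \<kappa>" "symtan_field \<T> \<sigma>"
  shows "symtan_field \<T> (curvature_residual M t \<kappa> \<sigma>)"
  unfolding curvature_residual_def[abs_def]
  by (intro symtan_field_diff symtan_field_scaleR symtan_field_material[OF assms(1,2)] assms)

text \<open>Symmetry and linearity of the material tensor give
  \<open>M(\<kappa> + s \<delta>) : (\<kappa> + s \<delta>) = M \<kappa> : \<kappa> + 2 s M \<kappa> : \<delta> + s^2 M \<delta> : \<delta>\<close> at every point. All terms are continuous on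
  the elements, so the expansion may be integrated term by term.\<close>

lemma bend3_along_line:
  assumes T: "\<And>e. e \<in> \<T> \<Longrightarrow> surface_element e" and M: "material_tensor Y p M"
    and u: "admissible_displacement \<T> u" and \<sigma>: "symtan_field \<T> \<sigma>"
    and \<kappa>: "symtan_field \<T> \<kappa>" and \<delta>: "symtan_field \<T> \<delta>"
  shows "bend3 \<T> L R M t u (\<lambda>e x. \<kappa> e x + s *\<^sub>R \<delta> e x) \<sigma>
    = bend3 \<T> L R M t u \<kappa> \<sigma>
      + s * surf_integral \<T> (\<lambda>e x. curvature_residual M t \<kappa> \<sigma> e x \<Colon> \<delta> e x)
      + s^2 * surf_integral \<T> (\<lambda>e x. t^3 / 24 * sqnorm M (elt_normal e x) (\<delta> e x))"
proof -
  have smooth: "smooth_on_set (elt_set e) (\<tau> e)" if "symtan_field \<T> \<tau>" "e \<in> \<T>" for \<tau> e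
    using that unfolding symtan_field_def by blast
  define f where "f e x = t^3 / 24 * sqnorm M (elt_normal e x) (\<kappa> e x)
     + (curvature_diff u e x - \<kappa> e x) \<Colon> \<sigma> e x" for e x
  define g where "g e x = curvature_residual M t \<kappa> \<sigma> e x \<Colon> \<delta> e x" for e x
  define h where "h e x = t^3 / 24 * sqnorm M (elt_normal e x) (\<delta> e x)" for e x
  have fs: "smooth_on_set (elt_set e) (f e)" if "e \<in> \<T>" for e
    unfolding f_def[abs_def] sqnorm_def using u that unfolding admissible_displacement_def
    by (intro smooth_on_set_add smooth_on_set_mult smooth_on_set_const smooth_on_set_frob
        smooth_on_set_diff curvature_diff_smooth smooth[OF symtan_field_material[OF T M \<kappa>]]
        smooth[OF \<kappa>] smooth[OF \<sigma>] T) auto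
  have gs: "smooth_on_set (elt_set e) (g e)" if "e \<in> \<T>" for e
    unfolding g_def[abs_def]
    by (intro smooth_on_set_frob smooth[OF symtan_field_curvature_residual[OF T M \<kappa> \<sigma>] that]
        smooth[OF \<delta> that]) 
  have hs: "smooth_on_set (elt_set e) (h e)" if "e \<in> \<T>" for e
    unfolding h_def[abs_def] sqnorm_def
    by (intro smooth_on_set_mult smooth_on_set_const smooth_on_set_frob
        smooth[OF symtan_field_material[OF T M \<delta>] that] smooth[OF \<delta> that])
  have pointwise: "t^3 / 24 * sqnorm M (elt_normal e x) (\<kappa> e x + s *\<^sub>R \<delta> e x)
      + (curvature_diff u e x - (\<kappa> e x + s *\<^sub>R \<delta> e x)) \<Colon> \<sigma> e x
      = f e x + (s * g e x + s^2 * h e x)" if e: "e \<in> \<T>" and x: "x \<in> elt_set e" for e x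
  proof -
    let ?n = "elt_normal e x"
    have n: "norm ?n = 1" by (rule norm_elt_normal[OF T[OF e] x])
    have k: "\<kappa> e x \<in> symtan ?n" and d: "\<delta> e x \<in> symtan ?n"
      using \<kappa> \<delta> e x unfolding symtan_field_def by auto
    have sd: "s *\<^sub>R \<delta> e x \<in> symtan ?n" by (rule subspace_scale[OF subspace_symtan d])
    have "M ?n (\<kappa> e x + s *\<^sub>R \<delta> e x) = M ?n (\<kappa> e x) + s *\<^sub>R M ?n (\<delta> e x)"
      using M n k d sd unfolding material_tensor_def by metis
    moreover have "M ?n (\<delta> e x) \<bullet> \<kappa> e x = M ?n (\<kappa> e x) \<bullet> \<delta> e x"
      using M n k d unfolding material_tensor_def frob_eq_inner by (metis inner_commute)
    ultimately show ?thesis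
      unfolding f_def g_def h_def sqnorm_def frob_eq_inner curvature_residual_def
      by (simp add: inner_add_left inner_add_right inner_diff_left inner_commute[of "\<delta> e x" "\<sigma> e x"]
          power2_eq_square algebra_simps)
  qed
  have smooth_cmult: "smooth_on_set S (\<lambda>x. c * F x)" if "smooth_on_set S F" for S c and F :: "real^3 \<Rightarrow> real"
    by (intro smooth_on_set_mult smooth_on_set_const that)
  have "surf_integral \<T> (\<lambda>e x. f e x + (s * g e x + s^2 * h e x))
    = surf_integral \<T> f + (s * surf_integral \<T> g + s^2 * surf_integral \<T> h)"
    by (simp add: surf_integral_add[OF T] surf_integral_cmult fs gs hs smooth_cmult smooth_on_set_add)
  then have "surf_integral \<T> (\<lambda>e x. t^3 / 24 * sqnorm M (elt_normal e x) (\<kappa> e x + s *\<^sub>R \<delta> e x)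
      + (curvature_diff u e x - (\<kappa> e x + s *\<^sub>R \<delta> e x)) \<Colon> \<sigma> e x)
    = surf_integral \<T> f + (s * surf_integral \<T> g + s^2 * surf_integral \<T> h)"
    using surf_integral_cong[OF pointwise] by simp
  then show ?thesis
    unfolding bend3_def f_def[abs_def] g_def[abs_def] h_def[abs_def] by simp
qed

lemma bend3_derivative:
  assumes T: "\<And>e. e \<in> \<T> \<Longrightarrow> surface_element e" and M: "material_tensor Y p M"
    and u: "admissible_displacement \<T> u" and \<sigma>: "symtan_field \<T> \<sigma>"
    and \<kappa>: "symtan_field \<T> \<kappa>" and \<delta>: "symtan_field \<T> \<delta>"
  shows "((\<lambda>s. bend3 \<T> L R M t u (\<lambda>e x. \<kappa> e x + s *\<^sub>R \<delta> e x) \<sigma>) has_real_derivative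
    surf_integral \<T> (\<lambda>e x. curvature_residual M t \<kappa> \<sigma> e x \<Colon> \<delta> e x)) (at 0)"
proof -
  have "bend3 \<T> L R M t u (\<lambda>e x. \<kappa> e x + s *\<^sub>R \<delta> e x) \<sigma>
    = bend3 \<T> L R M t u \<kappa> \<sigma>
      + s * surf_integral \<T> (\<lambda>e x. curvature_residual M t \<kappa> \<sigma> e x \<Colon> \<delta> e x)
      + s^2 * surf_integral \<T> (\<lambda>e x. t^3 / 24 * sqnorm M (elt_normal e x) (\<delta> e x))" for s
    by (rule bend3_along_line[OF T M u \<sigma> \<kappa> \<delta>])
  then show ?thesis
    by (auto intro!: derivative_eq_intros)
qed

text \<open>The residual is an admissible direction, so stationarity can be tested with it. Testing with the residual,
  and not with a difference of curvatures, relies on the definiteness of the inner product instead of that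
  of \<open>M\<close>, which may be indefinite.\<close>

lemma stationary_curvature_iff:
  assumes fin: "finite \<T>" and T: "\<And>e. e \<in> \<T> \<Longrightarrow> surface_element e" and M: "material_tensor Y p M"
    and u: "admissible_displacement \<T> u" and \<sigma>: "symtan_field \<T> \<sigma>" and \<kappa>: "symtan_field \<T> \<kappa>"
  shows "stationary_curvature \<T> L R M t u \<sigma> \<kappa> \<longleftrightarrow>
    (\<forall>e\<in>\<T>. \<forall>x\<in>elt_set e. curvature_residual M t \<kappa> \<sigma> e x = 0)"
proof
  let ?r = "curvature_residual M t \<kappa> \<sigma>"
  assume st: "stationary_curvature \<T> L R M t u \<sigma> \<kappa>"
  have r: "symtan_field \<T> ?r"
    by (rule symtan_field_curvature_residual[OF T M \<kappa> \<sigma>])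
  have "surf_integral \<T> (\<lambda>e x. ?r e x \<Colon> ?r e x) = 0"
    using DERIV_unique[OF bend3_derivative[OF T M u \<sigma> \<kappa> r]] st r
    unfolding stationary_curvature_def by blast
  then have "?r e x \<Colon> ?r e x = 0" if "e \<in> \<T>" "x \<in> elt_set e" for e x
    using that r unfolding symtan_field_def
    by (intro surf_integral_eq_0_imp[OF fin T, of "\<lambda>e x. ?r e x \<Colon> ?r e x"] smooth_on_set_frob)
       (auto simp: frob_eq_inner)
  then show "\<forall>e\<in>\<T>. \<forall>x\<in>elt_set e. ?r e x = 0"
    by (simp add: frob_eq_inner)
next
  assume r: "\<forall>e\<in>\<T>. \<forall>x\<in>elt_set e. curvature_residual M t \<kappa> \<sigma> e x = 0"
  have "surf_integral \<T> (\<lambda>e x. curvature_residual M t \<kappa> \<sigma> e x \<Colon> \<delta> e x) = 0" for \<delta>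
  proof -
    have "surf_integral \<T> (\<lambda>e x. curvature_residual M t \<kappa> \<sigma> e x \<Colon> \<delta> e x) = surf_integral \<T> (\<lambda>e x. 0)"
      using r by (intro surf_integral_cong) (simp add: frob_eq_inner)
    also have "\<dots> = 0"
      using surf_integral_cmult[of \<T> 0 "\<lambda>e x. 0"] by simp
    finally show ?thesis .
  qed
  then show "stationary_curvature \<T> L R M t u \<sigma> \<kappa>"
    unfolding stationary_curvature_def
    using bend3_derivative[OF T M u \<sigma> \<kappa>, where L = L and R = R and t = t] by presburger
qed

lemma curvature_residual_eq_0_iff:
  assumes inv: "invertible_material M" and M: "material_tensor Y p M" and "t > 0"
    and n: "norm (elt_normal e x) = 1"
    and k: "\<kappa> e x \<in> symtan (elt_normal e x)" and s: "\<sigma> e x \<in> symtan (elt_normal e x)"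
  shows "curvature_residual M t \<kappa> \<sigma> e x = 0 \<longleftrightarrow>
    \<kappa> e x = (12 / t^3) *\<^sub>R material_inverse M (elt_normal e x) (\<sigma> e x)"
proof -
  let ?n = "elt_normal e x"
  let ?K = "(12 / t^3) *\<^sub>R material_inverse M ?n (\<sigma> e x)"
  have K: "?K \<in> symtan ?n"
    by (intro subspace_scale[OF subspace_symtan] material_inverse_symtan[OF inv n s])
  have "M ?n ?K = (12 / t^3) *\<^sub>R \<sigma> e x"
    using M n material_inverse_symtan[OF inv n s] unfolding material_tensor_def by metis
  moreover have "inj_on (M ?n) (symtan ?n)"
    using inv n unfolding invertible_material_def bij_betw_def by blast
  ultimately have "\<kappa> e x = ?K \<longleftrightarrow> M ?n (\<kappa> e x) = (12 / t^3) *\<^sub>R \<sigma> e x"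
    using k K by (metis inj_onD)
  also have "\<dots> \<longleftrightarrow> (t^3 / 12) *\<^sub>R M ?n (\<kappa> e x) = (t^3 / 12) *\<^sub>R (12 / t^3) *\<^sub>R \<sigma> e x"
    using \<open>t > 0\<close> by (subst scaleR_cancel_left) simp
  finally show ?thesis
    using \<open>t > 0\<close> by (simp add: curvature_residual_def)
qed

lemma bend3_eq_bend2:
  assumes T: "\<And>e. e \<in> \<T> \<Longrightarrow> surface_element e" and M: "material_tensor Y p M"
    and inv: "invertible_material M" and "t > 0"
    and u: "admissible_displacement \<T> u" and \<sigma>: "symtan_field \<T> \<sigma>"
  shows "bend3 \<T> L R M t u
           (\<lambda>e x. (12 / t^3) *\<^sub>R material_inverse M (elt_normal e x) (\<sigma> e x)) \<sigma>
         = bend2 \<T> L R M t u \<sigma>"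
proof -
  define f where "f e x = sqnorm (material_inverse M) (elt_normal e x) (\<sigma> e x)" for e x
  define g where "g e x = curvature_diff u e x \<Colon> \<sigma> e x" for e x
  define K where "K e x = (12 / t^3) *\<^sub>R material_inverse M (elt_normal e x) (\<sigma> e x)" for e x
  have smooth: "smooth_on_set (elt_set e) (\<tau> e)" if "symtan_field \<T> \<tau>" "e \<in> \<T>" for \<tau> e
    using that unfolding symtan_field_def by blast
  have fs: "smooth_on_set (elt_set e) (\<lambda>x. - 6 / t^3 * f e x)" if "e \<in> \<T>" for e
    unfolding f_def sqnorm_def
    by (intro smooth_on_set_mult smooth_on_set_const smooth_on_set_frob
        smooth[OF symtan_field_material_inverse[OF T M inv \<sigma>] that] smooth[OF \<sigma> that])
  have gs: "smooth_on_set (elt_set e) (g e)" if "e \<in> \<T>" for e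
    unfolding g_def[abs_def] using u that unfolding admissible_displacement_def
    by (intro smooth_on_set_frob curvature_diff_smooth smooth[OF \<sigma>] T) auto
  have "t^3 / 24 * sqnorm M (elt_normal e x) (K e x) + (curvature_diff u e x - K e x) \<Colon> \<sigma> e x
      = - 6 / t^3 * f e x + g e x" if e: "e \<in> \<T>" and x: "x \<in> elt_set e" for e x
  proof -
    let ?n = "elt_normal e x"
    have n: "norm ?n = 1" by (rule norm_elt_normal[OF T[OF e] x])
    have s: "\<sigma> e x \<in> symtan ?n"
      using \<sigma> e x unfolding symtan_field_def by auto
    have "M ?n (K e x) = (12 / t^3) *\<^sub>R \<sigma> e x"
      using M n material_inverse_symtan[OF inv n s] unfolding material_tensor_def K_def by metis
    then show ?thesis
      using \<open>t > 0\<close> unfolding f_def g_def sqnorm_def frob_eq_inner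
      by (simp add: K_def inner_diff_left inner_commute[of "\<sigma> e x" "material_inverse M ?n (\<sigma> e x)"]
          field_simps)
  qed
  then have "surf_integral \<T> (\<lambda>e x. t^3 / 24 * sqnorm M (elt_normal e x) (K e x)
        + (curvature_diff u e x - K e x) \<Colon> \<sigma> e x)
      = surf_integral \<T> (\<lambda>e x. - 6 / t^3 * f e x + g e x)"
    by (rule surf_integral_cong)
  also have "\<dots> = - 6 / t^3 * surf_integral \<T> f + surf_integral \<T> g"
    by (simp only: surf_integral_add[OF T fs gs] surf_integral_cmult)
  finally show ?thesis
    by (simp add: bend3_def bend2_def K_def f_def[abs_def] g_def[abs_def])
qed

theorem lemma3p1:
  fixes \<T> :: "element set"
    and L R :: "(real^3) set \<Rightarrow> side"
    and M :: "real^3 \<Rightarrow> real^3^3 \<Rightarrow> real^3^3"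
    and t young poisson :: real
  assumes "surface_triangulation \<T>"
    and "edge_labelling \<T> L R"
    and "t > 0"
    and "material_tensor young poisson M"
    and "invertible_material M"
  shows "(\<forall>u \<sigma>. admissible_displacement \<T> u \<and> admissible_moment \<T> \<sigma> \<longrightarrow>
            (\<exists>\<kappa>. symtan_field \<T> \<kappa> \<and> stationary_curvature \<T> L R M t u \<sigma> \<kappa> \<and>
               (\<forall>\<kappa>'. symtan_field \<T> \<kappa>' \<and> stationary_curvature \<T> L R M t u \<sigma> \<kappa>' \<longrightarrow>
                  (\<forall>e\<in>\<T>. \<forall>x\<in>elt_set e. \<kappa>' e x = \<kappa> e x)) \<and>
               bend3 \<T> L R M t u \<kappa> \<sigma> = bend2 \<T> L R M t u \<sigma>))
       \<and> (\<forall>n A. norm n = 1 \<and> A \<in> symtan n \<longrightarrow>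
            sqnorm (material_inverse M) n A
              = (1 + poisson) / young * (A \<Colon> A - poisson / (poisson + 1) * (trace A)^2))"
proof (intro conjI allI impI)
  fix n A assume "norm n = 1 \<and> A \<in> symtan n"
  then show "sqnorm (material_inverse M) n A
      = (1 + poisson) / young * (A \<Colon> A - poisson / (poisson + 1) * (trace A)^2)"
    using sqnorm_material_inverse[OF assms(4,5)] by blast
next
  fix u \<sigma> assume "admissible_displacement \<T> u \<and> admissible_moment \<T> \<sigma>"
  then have u: "admissible_displacement \<T> u" and \<sigma>: "symtan_field \<T> \<sigma>"
    by (auto simp: admissible_moment_def)
  have fin: "finite \<T>" and T: "\<And>e. e \<in> \<T> \<Longrightarrow> surface_element e"
    using assms(1) unfolding surface_triangulation_def by auto
  define K where "K e x = (12 / t^3) *\<^sub>R material_inverse M (elt_normal e x) (\<sigma> e x)" for e x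
  have K: "symtan_field \<T> K"
    unfolding K_def[abs_def]
    by (intro symtan_field_scaleR symtan_field_material_inverse[OF T assms(4,5)] \<sigma>)
  have stationary: "stationary_curvature \<T> L R M t u \<sigma> \<kappa> \<longleftrightarrow> (\<forall>e\<in>\<T>. \<forall>x\<in>elt_set e. \<kappa> e x = K e x)"
    if \<kappa>: "symtan_field \<T> \<kappa>" for \<kappa>
  proof -
    have "curvature_residual M t \<kappa> \<sigma> e x = 0 \<longleftrightarrow> \<kappa> e x = K e x"
      if "e \<in> \<T>" "x \<in> elt_set e" for e x
      unfolding K_def using that \<kappa> \<sigma> norm_elt_normal[OF T]
      by (intro curvature_residual_eq_0_iff[OF assms(5,4,3)]) (auto simp: symtan_field_def)
    moreover have "stationary_curvature \<T> L R M t u \<sigma> \<kappa> \<longleftrightarrow>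
        (\<forall>e\<in>\<T>. \<forall>x\<in>elt_set e. curvature_residual M t \<kappa> \<sigma> e x = 0)"
      by (rule stationary_curvature_iff[OF fin T assms(4) u \<sigma> \<kappa>])
    ultimately show ?thesis by blast
  qed
  have "bend3 \<T> L R M t u K \<sigma> = bend2 \<T> L R M t u \<sigma>"
    unfolding K_def[abs_def] by (rule bend3_eq_bend2[OF T assms(4,5,3) u \<sigma>])
  then show "\<exists>\<kappa>. symtan_field \<T> \<kappa> \<and> stationary_curvature \<T> L R M t u \<sigma> \<kappa> \<and>
      (\<forall>\<kappa>'. symtan_field \<T> \<kappa>' \<and> stationary_curvature \<T> L R M t u \<sigma> \<kappa>' \<longrightarrow>
         (\<forall>e\<in>\<T>. \<forall>x\<in>elt_set e. \<kappa>' e x = \<kappa> e x)) \<and>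
      bend3 \<T> L R M t u \<kappa> \<sigma> = bend2 \<T> L R M t u \<sigma>"
    using K stationary by (intro exI[of _ K]) auto
qed

end
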